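(* Let $d \ge n \ge 1$ be integers and let $W_n(\mathbb{C}^d)$ be the complex Stiefel manifold of $n$-tuples $(v_1,\dots,v_n)$ of vectors in $\mathbb{C}^d$ that are orthonormal with respect to the standard Hermitian inner product. Let the torus $(S^1)^n$ act on $W_n(\mathbb{C}^d)$ by $(\lambda_1,\dots,\lambda_n)\cdot(v_1,\dots,v_n) = (\lambda_1 v_1, \dots, \lambda_n v_n)$, and on $\mathbb{C}^{d-1}\oplus \mathbb{C}^{d-2}\oplus\dots\oplus\mathbb{C}^{d-n}$ by $(\lambda_1,\dots,\lambda_n)\cdot(w_1,\dots,w_n) = (\lambda_1 w_1,\dots,\lambda_n w_n)$, where $w_i \in \mathbb{C}^{d-i}$. Then every continuous $(S^1)^n$-equivariant map \[ f: W_n(\mathbb{C}^d) \longrightarrow \mathbb{C}^{d-1}\oplus \mathbb{C}^{d-2} \oplus \dots \oplus \mathbb{C}^{d-n} \] has a zero, i.e. there is $(v_1,\dots,v_n)\in W_n(\mathbb{C}^d)$ with $f(v_1,\dots,v_n)=0$.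
   Context: Here $S^1 = \{\lambda \in \mathbb{C} : |\lambda| = 1\}$ acting by complex scalar multiplication. *)

theory Defs
  imports "HOL-Analysis.Analysis"
begin

text \<open>
  The dimensions \<open>d - 1, \<dots>, d - n\<close> vary with the index, so vectors are coordinate functions
  rather than elements of a fixed type \<open>complex ^ 'n\<close>. The space \<open>\<complex>^m\<close> is the set of
  functions \<open>nat \<Rightarrow> complex\<close> vanishing outside \<open>{..<m}\<close>; an \<open>n\<close>-tuple of vectors is a function
  on \<open>nat\<close> vanishing outside \<open>{1..n}\<close>. Function types carry the product topology
  (from \<open>HOL-Analysis.Function_Topology\<close>), and the topology it induces on these sets is the usual
  Euclidean one, because only finitely many coordinates can be nonzero.
\<close>

definition complex_space :: "nat \<Rightarrow> (nat \<Rightarrow> complex) set" where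
  "complex_space m = {v. \<forall>k\<ge>m. v k = 0}"

definition hermitian_inner :: "nat \<Rightarrow> (nat \<Rightarrow> complex) \<Rightarrow> (nat \<Rightarrow> complex) \<Rightarrow> complex" where
  "hermitian_inner m v w = (\<Sum>k<m. v k * cnj (w k))"

definition direct_sum :: "nat \<Rightarrow> (nat \<Rightarrow> nat) \<Rightarrow> (nat \<Rightarrow> nat \<Rightarrow> complex) set" where
  "direct_sum n m =
    {w. (\<forall>i\<in>{1..n}. w i \<in> complex_space (m i)) \<and> (\<forall>i. i \<notin> {1..n} \<longrightarrow> w i = (\<lambda>k. 0))}"

definition stiefel :: "nat \<Rightarrow> nat \<Rightarrow> (nat \<Rightarrow> nat \<Rightarrow> complex) set" where
  "stiefel n d =
    {v \<in> direct_sum n (\<lambda>i. d).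
      \<forall>i\<in>{1..n}. \<forall>j\<in>{1..n}. hermitian_inner d (v i) (v j) = (if i = j then 1 else 0)}"

definition torus :: "nat \<Rightarrow> (nat \<Rightarrow> complex) set" where
  "torus n = ({1..n} \<rightarrow>\<^sub>E sphere 0 1)"

text \<open>
  The values of \<open>l\<close> outside \<open>{1..n}\<close> do not matter here, since tuples vanish there.
\<close>

definition torus_act ::
  "(nat \<Rightarrow> complex) \<Rightarrow> (nat \<Rightarrow> nat \<Rightarrow> complex) \<Rightarrow> (nat \<Rightarrow> nat \<Rightarrow> complex)" where
  "torus_act l v = (\<lambda>i k. l i * v i k)"

definition torus_equivariant_on ::
  "nat \<Rightarrow> (nat \<Rightarrow> nat \<Rightarrow> complex) set \<Rightarrow>
    ((nat \<Rightarrow> nat \<Rightarrow> complex) \<Rightarrow> (nat \<Rightarrow> nat \<Rightarrow> complex)) \<Rightarrow> bool" where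
  "torus_equivariant_on n X f \<longleftrightarrow>
    (\<forall>l\<in>torus n. \<forall>v\<in>X. f (torus_act l v) = torus_act l (f v))"

end

(*
  Suppose f has no zero. Extend f equivariantly from orthonormal tuples to all n-tuples of nonzero
  vectors and add the inner products <v_i, v_j> for j < i as further components. The result F has no
  zero, is equivariant for certain characters of the torus, and its number of components, n(d-1)
  complex ones, is the dimension of the quotient (CP^(d-1))^n. The model map v |-> (v_i(k),
  v_i(k) cnj(v_(d-k)(k))) has the same characters and vanishes only on the orbit with every v_i
  proportional to the unit vector e_(d-i).

  Let Y be the set of tuples with v_i(d-i) = 0 for some i. Modulo scalars Y has real codimension 2,
  so Y x [0,1] has dimension one less than the target and F restricted to Y is homotopic to the
  model map through equivariant maps without zeros. The complement of Y modulo scalars is an open cell, on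
  which F together with this homotopy becomes a map on a cube without zeros whose components have the right
  signs on the faces; this contradicts the Poincare-Miranda theorem.

  As the dimensions depend on the numbers n and d, the theorems on Euclidean space types do not
  apply; extension over low-dimensional sets is derived from Lipschitz approximation and a
  counting argument.
*)
theory Submission
  imports Defs
begin

section \<open>Extending maps without zeros\<close>

text \<open>Underneath is a degree computation. Modulo scalars the model map has a single zero, and
  on a suitable cell its components are nonnegative multiples of the matching cell coordinates, so a
  sign theorem on a cube can stand in for degree theory. Three choices make this work without
  quotient spaces. All nonzero scalars act, not only unit ones, so that the largest entry of each
  vector can be divided to 1; the normalised tuples form compact polydiscs that meet each orbit at
  most once, and equivariant maps correspond to arbitrary maps on them. The product of v_i and v_j
  with j < i is stored at index k = d - j, which fills row i of the target up to all k < d except d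
  - i; the components are thereby indexed exactly like the affine coordinates of the cell where
  every v_i(d - i) is nonzero. Finally, codimension 2 of Y is just enough: the homotopy parameter
  uses up one real dimension, and the other one lets Lipschitz maps miss a point of the
  target.\<close>

lemma lipschitz_approximation:
  fixes f :: "'a::metric_space \<Rightarrow> real"
  assumes "compact C" "continuous_on C f" "0 < e"
  obtains L g where "L-lipschitz_on UNIV g" "\<And>x. x \<in> C \<Longrightarrow> \<bar>g x - f x\<bar> < e"
proof (cases "C = {}")
  case True
  have "0-lipschitz_on UNIV (\<lambda>x::'a. 0::real)"
    by (simp add: lipschitz_on_def)
  with True that show ?thesis by blast
next
  case False
  obtain M where M: "0 < M" "\<And>x. x \<in> C \<Longrightarrow> \<bar>f x\<bar> \<le> M"
    using compact_imp_bounded[OF compact_continuous_image[OF assms(2,1)]]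
    unfolding bounded_pos by auto
  obtain \<delta> where \<delta>: "0 < \<delta>"
    "\<And>x y. x \<in> C \<Longrightarrow> y \<in> C \<Longrightarrow> dist y x < \<delta> \<Longrightarrow> dist (f y) (f x) < e / 2"
    using compact_uniformly_continuous[OF assms(2,1)] \<open>0 < e\<close>
    unfolding uniformly_continuous_on_def by (metis half_gt_zero)
  \<comment> \<open>\<open>g\<close> is an inf-convolution of \<open>f\<close> with slope
    \<open>L\<close>. At distance at least \<delta> this slope costs 2 M, the largest possible
    oscillation of \<open>f\<close>; so only points closer than \<delta>, where \<open>f\<close>
    varies by less than e / 2, can pull the infimum below \<open>f x\<close>.\<close>
  define L where "L = 2 * M / \<delta>"
  have "0 < L" using M \<delta> by (simp add: L_def)
  define g where "g x = (INF y\<in>C. f y + L * dist x y)" for x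
  have bdd: "bdd_below ((\<lambda>y. f y + L * dist x y) ` C)" for x
  proof (rule bdd_belowI2)
    show "- M \<le> f y + L * dist x y" if "y \<in> C" for y
      using M(2)[OF that] \<open>0 < L\<close> zero_le_dist[of x y] by (smt (verit) mult_nonneg_nonneg)
  qed
  have le: "g x \<le> g z + L * dist x z" for x z
  proof -
    have "g x - L * dist x z \<le> f y + L * dist z y" if "y \<in> C" for y
    proof -
      have "g x \<le> f y + L * dist x y"
        unfolding g_def by (rule cINF_lower[OF bdd that])
      also have "\<dots> \<le> f y + L * (dist x z + dist z y)"
        using \<open>0 < L\<close> by (simp add: dist_triangle)
      finally show ?thesis by (simp add: algebra_simps)
    qed
    then have "g x - L * dist x z \<le> g z"
      unfolding g_def[of z] using False by (intro cINF_greatest) auto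
    then show ?thesis by simp
  qed
  have "L-lipschitz_on UNIV g"
  proof (rule lipschitz_onI)
    fix x y
    show "dist (g x) (g y) \<le> L * dist x y"
      using le[of x y] le[of y x] by (auto simp: dist_real_def dist_commute abs_le_iff)
  qed (use \<open>0 < L\<close> in simp)
  moreover have "\<bar>g x - f x\<bar> < e" if x: "x \<in> C" for x
  proof -
    have "g x \<le> f x"
      using cINF_lower[OF bdd x, of x] by (simp add: g_def)
    moreover have "f x - e / 2 \<le> f y + L * dist x y" if y: "y \<in> C" for y
    proof (cases "dist y x < \<delta>")
      case True
      have "\<bar>f y - f x\<bar> < e / 2"
        using \<delta>(2)[OF x y True] by (simp add: dist_real_def)
      moreover have "0 \<le> L * dist x y" using \<open>0 < L\<close> by simp
      ultimately show ?thesis by linarith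
    next
      case False
      have "2 * M = L * \<delta>" using \<delta> by (simp add: L_def)
      also have "\<dots> \<le> L * dist x y"
        using False \<open>0 < L\<close> by (simp add: dist_commute)
      finally show ?thesis using M(2)[OF x] M(2)[OF y] \<open>0 < e\<close> by linarith
    qed
    then have "f x - e / 2 \<le> g x"
      unfolding g_def using False by (intro cINF_greatest) auto
    ultimately show ?thesis using \<open>0 < e\<close> by auto
  qed
  ultimately show ?thesis using that by blast
qed

text \<open>An upper bound on the box-counting (Minkowski) dimension, tested at the scales 1 / k. It
  makes sense in function spaces with the product metric, where the type carries no
  dimension.\<close>

definition box_dim_le :: "nat \<Rightarrow> 'a::metric_space set \<Rightarrow> bool" where
  "box_dim_le m Q \<longleftrightarrow>
    (\<exists>A B. \<forall>k\<ge>1. \<exists>\<U>. finite \<U> \<and> card \<U> \<le> A * k ^ m \<and> Q \<subseteq> \<Union>\<U> \<and>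
      (\<forall>U\<in>\<U>. \<forall>x\<in>U. \<forall>y\<in>U. dist x y \<le> B / real k))"

text \<open>Were all points of a grid with \<open>K ^ card J\<close> points attained, distinct grid points would
  have preimages in distinct sets of a cover by \<open>O(K ^ m)\<close> small sets.\<close>

lemma lipschitz_avoids_small_point:
  fixes g :: "'j \<Rightarrow> 'a::metric_space \<Rightarrow> real"
  assumes "finite J" and lip: "\<And>j. j \<in> J \<Longrightarrow> \<exists>L. L-lipschitz_on Q (g j)"
    and Q: "box_dim_le m Q" and "m < card J" and "0 < \<delta>"
  shows "\<exists>p. (\<forall>j. \<bar>p j\<bar> \<le> \<delta>) \<and> (\<forall>x\<in>Q. \<exists>j\<in>J. g j x \<noteq> p j)"
proof (rule ccontr)
  assume contra: "\<not> ?thesis"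
  from Q obtain A B where cover: "\<forall>k\<ge>1. \<exists>\<U>. finite \<U> \<and> card \<U> \<le> A * k ^ m \<and> Q \<subseteq> \<Union>\<U> \<and>
      (\<forall>U\<in>\<U>. \<forall>x\<in>U. \<forall>y\<in>U. dist x y \<le> B / real k)"
    unfolding box_dim_le_def by (elim exE)
  obtain l where l: "\<And>j. j \<in> J \<Longrightarrow> (l j)-lipschitz_on Q (g j)"
    using lip by metis
  define L where "L = (\<Sum>j\<in>J. l j)"
  have l_le: "l j \<le> L" if "j \<in> J" for j
    unfolding L_def using \<open>finite J\<close> that l lipschitz_on_nonneg
    by (intro member_le_sum) auto
  have "L \<ge> 0" unfolding L_def using l lipschitz_on_nonneg by (intro sum_nonneg) blast
  obtain c :: nat where c: "L * \<bar>B\<bar> / \<delta> < real c"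
    using reals_Archimedean2 by blast
  have "1 \<le> c"
    using c \<open>0 < \<delta>\<close> mult_nonneg_nonneg[OF \<open>0 \<le> L\<close> abs_ge_zero[of B]]
    by (cases c) (auto simp: field_simps)
  \<comment> \<open>At scale 1 / (c K), the choice of \<open>c\<close> makes the images of one
    covering set differ by less than the grid spacing \<delta> / K. Since \<open>K\<close> exceeds
    \<open>A * c ^ m\<close>, the \<open>K ^ card J\<close> grid points outnumber the
    \<open>A * (c * K) ^ m\<close> covering sets.\<close>
  define K where "K = A * c ^ m + 1"
  have "1 \<le> c * K" using \<open>1 \<le> c\<close> by (simp add: K_def)
  then obtain \<U> where \<U>: "finite \<U>" "card \<U> \<le> A * (c * K) ^ m" "Q \<subseteq> \<Union>\<U>"
    and small: "\<forall>U\<in>\<U>. \<forall>x\<in>U. \<forall>y\<in>U. dist x y \<le> B / real (c * K)"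
    using cover by (elim allE impE exE conjE) (assumption, blast)
  have \<U>4: "dist x y \<le> B / real (c * K)" if "U \<in> \<U>" "x \<in> U" "y \<in> U" for U x y
    using small that by blast
  define grid where "grid = (J \<rightarrow>\<^sub>E {..<K})"
  have "\<exists>x\<in>Q. \<forall>j\<in>J. g j x = \<delta> * real (a j) / real K" if a: "a \<in> grid" for a
  proof (rule ccontr)
    assume no: "\<not> ?thesis"
    define p where "p j = (if j \<in> J then \<delta> * real (a j) / real K else 0)" for j
    have "\<bar>p j\<bar> \<le> \<delta>" for j
    proof (cases "j \<in> J")
      case True
      then have "a j < K" using a by (auto simp: grid_def)
      then show ?thesis using True \<open>0 < \<delta>\<close> by (simp add: p_def field_simps)
    qed (use \<open>0 < \<delta>\<close> in \<open>simp add: p_def\<close>)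
    moreover have "\<exists>j\<in>J. g j x \<noteq> p j" if "x \<in> Q" for x
      using no that by (auto simp: p_def)
    ultimately show False using contra by blast
  qed
  then have "\<forall>a\<in>grid. \<exists>x. x \<in> Q \<and> (\<forall>j\<in>J. g j x = \<delta> * real (a j) / real K)"
    by blast
  from bchoice[OF this] obtain X where X0: "\<forall>a\<in>grid. X a \<in> Q \<and>
      (\<forall>j\<in>J. g j (X a) = \<delta> * real (a j) / real K)"
    by (elim exE)
  then have X: "\<And>a. a \<in> grid \<Longrightarrow> X a \<in> Q"
    "\<And>a j. a \<in> grid \<Longrightarrow> j \<in> J \<Longrightarrow> g j (X a) = \<delta> * real (a j) / real K"
    by blast+
  then have "\<forall>a\<in>grid. \<exists>V. V \<in> \<U> \<and> X a \<in> V"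
    using \<U>(3) by blast
  from bchoice[OF this] obtain U where U0: "\<forall>a\<in>grid. U a \<in> \<U> \<and> X a \<in> U a"
    by (elim exE)
  then have U: "\<And>a. a \<in> grid \<Longrightarrow> U a \<in> \<U>" "\<And>a. a \<in> grid \<Longrightarrow> X a \<in> U a"
    by blast+
  have "inj_on U grid"
  proof (rule inj_onI)
    fix a b assume ab: "a \<in> grid" "b \<in> grid" "U a = U b"
    have "a j = b j" if j: "j \<in> J" for j
    proof -
      have "\<delta> * \<bar>real (a j) - real (b j)\<bar> / real K = \<bar>g j (X a) - g j (X b)\<bar>"
        using \<open>0 < \<delta>\<close> X(2)[OF ab(1) j] X(2)[OF ab(2) j]
        by (simp add: K_def abs_mult flip: diff_divide_distrib right_diff_distrib)
      also have "\<dots> \<le> l j * dist (X a) (X b)"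
        using lipschitz_onD[OF l[OF j] X(1)[OF ab(1)] X(1)[OF ab(2)]]
        by (simp add: dist_real_def)
      also have "\<dots> \<le> L * dist (X a) (X b)"
        using l_le[OF j] by (simp add: mult_right_mono)
      also have "\<dots> \<le> L * (B / real (c * K))"
        using \<U>4[OF U(1)[OF ab(1)] U(2)[OF ab(1)], of "X b"] U(2)[OF ab(2)] ab(3) \<open>0 \<le> L\<close>
        by (intro mult_left_mono) auto
      also have "\<dots> \<le> L * (\<bar>B\<bar> / real (c * K))"
        using \<open>0 \<le> L\<close> by (intro mult_left_mono divide_right_mono) auto
      also have "\<dots> = (L * \<bar>B\<bar>) / (real c * real K)"
        by simp
      also have "\<dots> < (\<delta> * real c) / (real c * real K)"
        using c \<open>0 < \<delta>\<close> \<open>1 \<le> c * K\<close>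
        by (intro divide_strict_right_mono) (auto simp: field_simps simp flip: of_nat_mult)
      also have "\<dots> = \<delta> / real K"
        using \<open>1 \<le> c\<close> by simp
      finally have "\<delta> * \<bar>real (a j) - real (b j)\<bar> / real K < \<delta> / real K" .
      moreover have "0 < real K" unfolding of_nat_0_less_iff by (simp add: K_def)
      ultimately have "\<delta> * \<bar>real (a j) - real (b j)\<bar> < \<delta> * 1"
        by (simp add: divide_less_cancel)
      then have "\<bar>real (a j) - real (b j)\<bar> < 1"
        using \<open>0 < \<delta>\<close> by (simp only: mult_less_cancel_left_pos)
      then show ?thesis by linarith
    qed
    then show "a = b"
      using ab unfolding grid_def by (intro PiE_ext) auto
  qed
  then have "card grid \<le> card \<U>"
    using U(1) \<U>(1) by (intro card_inj_on_le) auto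
  then have "K ^ card J \<le> A * c ^ m * K ^ m"
    using \<U>(2) \<open>finite J\<close> by (simp add: grid_def card_PiE power_mult_distrib mult.assoc)
  moreover have "K * K ^ m \<le> K ^ card J"
    using \<open>m < card J\<close> power_increasing[of "Suc m" "card J" K] by (simp add: K_def)
  ultimately have "K * K ^ m \<le> A * c ^ m * K ^ m"
    by linarith
  then show False by (simp add: K_def)
qed

text \<open>A small shift of a Lipschitz approximation avoids 0 on all of \<open>Q\<close>, but no
  longer equals \<open>f\<close> on \<open>C\<close>. The error, extended by Tietze's theorem, is
  added back with a cutoff supported where the approximation is large compared with the error, so
  that no zero is created.\<close>

lemma nonvanishing_extension_real:
  fixes f :: "'j \<Rightarrow> 'a::{metric_space,second_countable_topology} \<Rightarrow> real"
  assumes "compact Q" "box_dim_le m Q" "finite J" "m < card J" "closed C" "C \<subseteq> Q"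
    and contf: "\<And>j. j \<in> J \<Longrightarrow> continuous_on C (f j)"
    and nz: "\<And>x. x \<in> C \<Longrightarrow> \<exists>j\<in>J. f j x \<noteq> 0"
  shows "\<exists>h. (\<forall>j\<in>J. continuous_on Q (h j)) \<and> (\<forall>j\<in>J. \<forall>x\<in>C. h j x = f j x) \<and>
    (\<forall>x\<in>Q. \<exists>j\<in>J. h j x \<noteq> 0)"
proof -
  have "compact C"
    using assms by (metis compact_Int_closed inf.absorb_iff2 inf_commute)
  have "0 < card J" using assms by simp
  obtain c where "0 < c" and c: "\<And>x. x \<in> C \<Longrightarrow> c \<le> (\<Sum>j\<in>J. \<bar>f j x\<bar>)"
  proof (cases "C = {}")
    case False
    have "continuous_on C (\<lambda>x. \<Sum>j\<in>J. \<bar>f j x\<bar>)"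
      by (intro continuous_intros contf)
    from continuous_attains_inf[OF \<open>compact C\<close> False this]
    obtain z where z: "z \<in> C" "\<And>x. x \<in> C \<Longrightarrow> (\<Sum>j\<in>J. \<bar>f j z\<bar>) \<le> (\<Sum>j\<in>J. \<bar>f j x\<bar>)"
      by blast
    have "(\<Sum>j\<in>J. \<bar>f j z\<bar>) \<noteq> 0"
      using nz[OF z(1)] \<open>finite J\<close> by (auto simp: sum_nonneg_eq_0_iff)
    then have "0 < (\<Sum>j\<in>J. \<bar>f j z\<bar>)"
      using sum_nonneg[of J "\<lambda>j. \<bar>f j z\<bar>"] by (simp add: order_less_le)
    with z(2) show ?thesis using that by blast
  qed (use that[of 1] in auto)
  \<comment> \<open>Approximation and shift cost \<eta> each, so on \<open>C\<close> all components
    together are off by at most c / 4, a quarter of the lower bound for \<open>f\<close>.\<close>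
  define \<eta> where "\<eta> = c / (8 * real (card J))"
  have "0 < \<eta>" using \<open>0 < c\<close> \<open>0 < card J\<close> by (simp add: \<eta>_def)
  have \<eta>: "real (card J) * (2 * \<eta>) = c / 4"
    using \<open>0 < card J\<close> by (simp add: \<eta>_def)
  have "\<exists>g. (\<exists>L. L-lipschitz_on UNIV g) \<and> (\<forall>x\<in>C. \<bar>g x - f j x\<bar> < \<eta>)" if "j \<in> J" for j
    using lipschitz_approximation[OF \<open>compact C\<close> contf[OF that] \<open>0 < \<eta>\<close>] by metis
  then obtain g where lip: "\<And>j. j \<in> J \<Longrightarrow> \<exists>L. L-lipschitz_on UNIV (g j)"
    and g: "\<And>j x. j \<in> J \<Longrightarrow> x \<in> C \<Longrightarrow> \<bar>g j x - f j x\<bar> < \<eta>"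
    by metis
  have lipQ: "\<exists>L. L-lipschitz_on Q (g j)" if "j \<in> J" for j
    using lip[OF that] lipschitz_on_subset by blast
  have "\<exists>p. (\<forall>j. \<bar>p j\<bar> \<le> \<eta>) \<and> (\<forall>x\<in>Q. \<exists>j\<in>J. g j x \<noteq> p j)"
    by (rule lipschitz_avoids_small_point) (use assms lipQ \<open>0 < \<eta>\<close> in auto)
  then obtain p where p: "\<And>j. \<bar>p j\<bar> \<le> \<eta>" "\<And>x. x \<in> Q \<Longrightarrow> \<exists>j\<in>J. g j x \<noteq> p j"
    by blast
  define h where "h j x = g j x - p j" for j x
  have conth: "continuous_on S (h j)" if "j \<in> J" for j S
    unfolding h_def using lip[OF that] lipschitz_on_continuous_on
    by (auto intro!: continuous_intros intro: continuous_on_subset)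
  have h: "\<bar>f j x - h j x\<bar> \<le> 2 * \<eta>" if "j \<in> J" "x \<in> C" for j x
    using g[OF that] p(1)[of j] by (auto simp: h_def)
  have hnz: "0 < (\<Sum>j\<in>J. \<bar>h j x\<bar>)" if "x \<in> Q" for x
  proof -
    have "(\<Sum>j\<in>J. \<bar>h j x\<bar>) \<noteq> 0"
      using p(2)[OF that] \<open>finite J\<close> by (auto simp: sum_nonneg_eq_0_iff h_def)
    then show ?thesis using sum_nonneg[of J "\<lambda>j. \<bar>h j x\<bar>"] by (simp add: order_less_le)
  qed
  have "\<exists>\<phi>. continuous_on Q \<phi> \<and> (\<forall>x\<in>C. \<phi> x = f j x - h j x) \<and> (\<forall>x\<in>Q. \<bar>\<phi> x\<bar> \<le> 2 * \<eta>)"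
    if "j \<in> J" for j
  proof (rule Tietze[of C "\<lambda>x. f j x - h j x" Q "2 * \<eta>"])
    show "continuous_on C (\<lambda>x. f j x - h j x)"
      by (intro continuous_intros contf conth that)
    show "closedin (top_of_set Q) C"
      using \<open>closed C\<close> \<open>C \<subseteq> Q\<close> by (rule closed_subset[rotated])
  qed (use h that \<open>0 < \<eta>\<close> in auto)
  then obtain \<phi> where cont\<phi>: "\<And>j. j \<in> J \<Longrightarrow> continuous_on Q (\<phi> j)"
    and \<phi>: "\<And>j x. j \<in> J \<Longrightarrow> x \<in> C \<Longrightarrow> \<phi> j x = f j x - h j x"
    and \<phi>_le: "\<And>j x. j \<in> J \<Longrightarrow> x \<in> Q \<Longrightarrow> \<bar>\<phi> j x\<bar> \<le> 2 * \<eta>"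
    by metis
  define T where "T x = (\<Sum>j\<in>J. \<bar>h j x\<bar>)" for x
  \<comment> \<open>The cutoff is 0 where \<open>T\<close> is at most c / 4 and 1 from c / 2 on; on
    \<open>C\<close> the value of \<open>T\<close> is at least 3 c / 4. At a common zero of the
    corrected map \<open>T\<close> would be at most c / 4, hence u = 0, and then T = 0.\<close>
  define u where "u x = max 0 (min 1 ((T x - c / 4) / (c / 4)))" for x
  have contT: "continuous_on Q T"
    unfolding T_def by (intro continuous_intros conth)
  have u: "u x = 1" if "x \<in> C" for x
  proof -
    have "c \<le> (\<Sum>j\<in>J. \<bar>f j x\<bar>)" using c that .
    also have "\<dots> \<le> (\<Sum>j\<in>J. \<bar>h j x\<bar> + 2 * \<eta>)"
      using h[OF _ that] by (intro sum_mono) (smt (verit))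
    also have "\<dots> = T x + c / 4"
      using \<eta> by (simp add: sum.distrib T_def)
    finally show ?thesis using \<open>0 < c\<close> by (simp add: u_def field_simps)
  qed
  show ?thesis
  proof (intro exI[of _ "\<lambda>j x. h j x + u x * \<phi> j x"] conjI ballI)
    show "continuous_on Q (\<lambda>x. h j x + u x * \<phi> j x)" if "j \<in> J" for j
      unfolding u_def using \<open>0 < c\<close>
      by (intro continuous_intros conth cont\<phi> contT that) auto
    show "h j x + u x * \<phi> j x = f j x" if "j \<in> J" "x \<in> C" for j x
      using that by (simp add: u \<phi>)
    show "\<exists>j\<in>J. h j x + u x * \<phi> j x \<noteq> 0" if x: "x \<in> Q" for x
    proof (rule ccontr)
      assume "\<not> ?thesis"
      then have "\<bar>h j x\<bar> = u x * \<bar>\<phi> j x\<bar>" if "j \<in> J" for j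
        using that by (smt (verit) abs_mult abs_of_nonneg mult_minus_right u_def abs_minus_cancel)
      then have T_eq: "T x = u x * (\<Sum>j\<in>J. \<bar>\<phi> j x\<bar>)"
        by (simp add: T_def sum_distrib_left)
      have "(\<Sum>j\<in>J. \<bar>\<phi> j x\<bar>) \<le> c / 4"
        using sum_mono[of J "\<lambda>j. \<bar>\<phi> j x\<bar>" "\<lambda>j. 2 * \<eta>"] \<phi>_le[OF _ x] \<eta> by simp
      moreover have "0 \<le> (\<Sum>j\<in>J. \<bar>\<phi> j x\<bar>)" by (simp add: sum_nonneg)
      moreover have "0 \<le> u x" "u x \<le> 1" by (auto simp: u_def)
      ultimately have "T x \<le> c / 4"
        using T_eq by (smt (verit) mult_left_le_one_le)
      then have "u x = 0" using \<open>0 < c\<close> by (simp add: u_def field_simps)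
      with T_eq hnz[OF x] show False by (simp add: T_def)
    qed
  qed
qed

lemma nonvanishing_extension:
  fixes f :: "'a::{metric_space,second_countable_topology} \<Rightarrow> 'j \<Rightarrow> complex"
  assumes "compact Q" "box_dim_le m Q" "finite J" "m < 2 * card J" "closed C" "C \<subseteq> Q"
    and contf: "\<And>j. j \<in> J \<Longrightarrow> continuous_on C (\<lambda>x. f x j)"
    and nz: "\<And>x. x \<in> C \<Longrightarrow> \<exists>j\<in>J. f x j \<noteq> 0"
  shows "\<exists>h. (\<forall>j\<in>J. continuous_on Q (\<lambda>x. h x j)) \<and> (\<forall>j\<in>J. \<forall>x\<in>C. h x j = f x j) \<and>
    (\<forall>x\<in>Q. \<exists>j\<in>J. h x j \<noteq> 0)"
proof -
  define r where "r = (\<lambda>(j, b) x. if b then Re (f x j) else Im (f x j))"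
  have "\<exists>h. (\<forall>jb\<in>J \<times> UNIV. continuous_on Q (h jb)) \<and>
      (\<forall>jb\<in>J \<times> UNIV. \<forall>x\<in>C. h jb x = r jb x) \<and> (\<forall>x\<in>Q. \<exists>jb\<in>J \<times> UNIV. h jb x \<noteq> 0)"
  proof (rule nonvanishing_extension_real[OF assms(1,2) _ _ assms(5,6), of "J \<times> UNIV" r])
    show "continuous_on C (r jb)" if "jb \<in> J \<times> UNIV" for jb
      using that contf by (cases "snd jb") (auto simp: r_def intro!: continuous_intros)
    show "\<exists>jb\<in>J \<times> UNIV. r jb x \<noteq> 0" if "x \<in> C" for x
      using nz[OF that] by (auto simp: r_def complex_eq_iff Bex_def)
    show "finite (J \<times> (UNIV :: bool set))" "m < card (J \<times> (UNIV :: bool set))"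
      using assms by (simp_all add: card_cartesian_product)
  qed
  then obtain h where h: "\<forall>jb\<in>J \<times> UNIV. continuous_on Q (h jb)"
    "\<forall>jb\<in>J \<times> UNIV. \<forall>x\<in>C. h jb x = r jb x" "\<forall>x\<in>Q. \<exists>jb\<in>J \<times> UNIV. h jb x \<noteq> 0"
    by (elim exE conjE)
  show ?thesis
  proof (intro exI[of _ "\<lambda>x j. Complex (h (j, True) x) (h (j, False) x)"] conjI ballI)
    show "continuous_on Q (\<lambda>x. Complex (h (j, True) x) (h (j, False) x))" if "j \<in> J" for j
      unfolding Complex_eq using h(1) that by (intro continuous_intros) auto
    show "Complex (h (j, True) x) (h (j, False) x) = f x j" if "j \<in> J" "x \<in> C" for j x
      using that by (simp add: h(2) r_def)
    show "\<exists>j\<in>J. Complex (h (j, True) x) (h (j, False) x) \<noteq> 0" if x: "x \<in> Q" for x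
    proof -
      obtain j b where "j \<in> J" "h (j, b) x \<noteq> 0" using bspec[OF h(3) x] by auto
      then show ?thesis by (cases b) (auto simp: complex_eq_iff)
    qed
  qed
qed

section \<open>The Poincare-Miranda theorem\<close>

text \<open>The product metric weights the coordinates by the powers of 1/2 starting at 1; their sum
  is the factor 2.\<close>

lemma dist_fun_le:
  fixes x y :: "'i::countable \<Rightarrow> 'a::metric_space"
  assumes "\<And>i. dist (x i) (y i) \<le> e"
  shows "dist x y \<le> 2 * e"
proof -
  have "dist x y \<le> 2 * e + (1/2) ^ N" for N
  proof -
    have "Max {dist (x (from_nat n)) (y (from_nat n)) |n. n \<le> N} \<le> e"
      using assms by (intro Max.boundedI) auto
    then show ?thesis
      using dist_fun_le_dist_first_terms[of x y N] by linarith
  qed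
  moreover have "(\<lambda>N. 2 * e + (1/2) ^ N) \<longlonglongrightarrow> 2 * e + (0::real)"
    by (intro tendsto_intros LIMSEQ_power_zero) auto
  ultimately show ?thesis
    by (auto intro: LIMSEQ_le_const)
qed

lemma compact_coordinatewise:
  fixes K :: "'i \<Rightarrow> 'a::topological_space set"
  assumes "\<And>i. compact (K i)"
  shows "compact {x. \<forall>i. x i \<in> K i}"
proof -
  have "compactin (product_topology (\<lambda>i. euclidean) UNIV) (PiE UNIV K)"
    using assms by (simp add: compactin_PiE)
  then show ?thesis
    by (simp add: euclidean_product_topology PiE_def Pi_def)
qed

lemma finite_common_uniform_continuity:
  fixes f :: "'i \<Rightarrow> 'a::metric_space \<Rightarrow> real"
  assumes "finite I" "compact Q" "\<And>i. i \<in> I \<Longrightarrow> continuous_on Q (f i)" "0 < e"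
  shows "\<exists>\<delta>>0. \<forall>i\<in>I. \<forall>x\<in>Q. \<forall>y\<in>Q. dist x y < \<delta> \<longrightarrow> \<bar>f i x - f i y\<bar> < e"
  using assms(1,3)
proof (induction I rule: finite_induct)
  case empty
  then show ?case by (auto intro: exI[of _ 1])
next
  case (insert i I)
  obtain \<delta>1 where "\<delta>1 > 0" "\<forall>j\<in>I. \<forall>x\<in>Q. \<forall>y\<in>Q. dist x y < \<delta>1 \<longrightarrow> \<bar>f j x - f j y\<bar> < e"
    using insert by auto
  moreover obtain \<delta>2 where "\<delta>2 > 0" "\<forall>x\<in>Q. \<forall>y\<in>Q. dist x y < \<delta>2 \<longrightarrow> \<bar>f i x - f i y\<bar> < e"
    using compact_uniformly_continuous[of Q "f i"] insert.prems \<open>compact Q\<close> \<open>0 < e\<close>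
    unfolding uniformly_continuous_on_def dist_real_def by (metis dist_commute insertI1)
  ultimately show ?case
    by (intro exI[of _ "min \<delta>1 \<delta>2"]) auto
qed

text \<open>Pinning the other coordinates to 0 gives a compact cube whose dimension
  \<open>card I\<close> may depend on variables.\<close>

definition cube :: "'i set \<Rightarrow> real \<Rightarrow> real \<Rightarrow> ('i \<Rightarrow> real) set" where
  "cube I a b = {x. (\<forall>i\<in>I. x i \<in> {a..b}) \<and> (\<forall>i. i \<notin> I \<longrightarrow> x i = 0)}"

text \<open>Kuhn's combinatorial lemma, the one behind Brouwer's theorem, is applied to sign labels
  on a fine grid: in some grid cell every component takes both labels, hence is small there. Without
  a common zero the sum of the absolute values would have a positive minimum \<open>c\<close>, which
  a fine enough grid contradicts.\<close>

lemma poincare_miranda: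
  fixes G :: "('i::countable \<Rightarrow> real) \<Rightarrow> 'i \<Rightarrow> real"
  assumes "finite I" "a < b"
    and cont: "\<And>i. i \<in> I \<Longrightarrow> continuous_on (cube I a b) (\<lambda>x. G x i)"
    and low: "\<And>x i. x \<in> cube I a b \<Longrightarrow> i \<in> I \<Longrightarrow> x i = a \<Longrightarrow> G x i \<le> 0"
    and high: "\<And>x i. x \<in> cube I a b \<Longrightarrow> i \<in> I \<Longrightarrow> x i = b \<Longrightarrow> 0 \<le> G x i"
  shows "\<exists>x\<in>cube I a b. \<forall>i\<in>I. G x i = 0"
proof (rule ccontr)
  assume nz: "\<not> ?thesis"
  let ?Q = "cube I a b"
  have "?Q = {x. \<forall>i. x i \<in> (if i \<in> I then {a..b} else {0})}"
    by (auto simp: cube_def)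
  moreover have "compact {x. \<forall>i. x i \<in> (if i \<in> I then {a..b} else {0})}"
    by (rule compact_coordinatewise) simp
  ultimately have comp: "compact ?Q" by simp
  have a_in: "(\<lambda>i. if i \<in> I then a else 0) \<in> ?Q" using \<open>a < b\<close> by (simp add: cube_def)
  then have ne: "?Q \<noteq> {}" by blast
  have "I \<noteq> {}" using nz a_in by auto
  then have N: "0 < card I" using \<open>finite I\<close> by (simp add: card_gt_0_iff)
  have "continuous_on ?Q (\<lambda>x. \<Sum>i\<in>I. \<bar>G x i\<bar>)"
    by (intro continuous_intros cont)
  then obtain z where z: "z \<in> ?Q" "\<And>x. x \<in> ?Q \<Longrightarrow> (\<Sum>i\<in>I. \<bar>G z i\<bar>) \<le> (\<Sum>i\<in>I. \<bar>G x i\<bar>)"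
    using continuous_attains_inf[OF comp ne] by blast
  define c where "c = (\<Sum>i\<in>I. \<bar>G z i\<bar>)"
  have "c \<noteq> 0"
    using nz z(1) \<open>finite I\<close> by (auto simp: c_def sum_nonneg_eq_0_iff)
  then have "0 < c" using sum_nonneg[of I "\<lambda>i. \<bar>G z i\<bar>"] by (simp add: c_def order_less_le)
  define \<eta> where "\<eta> = c / (2 * real (card I))"
  have "0 < \<eta>" using \<open>0 < c\<close> N by (simp add: \<eta>_def)
  obtain \<delta> where "0 < \<delta>"
    and \<delta>: "\<forall>i\<in>I. \<forall>x\<in>?Q. \<forall>y\<in>?Q. dist x y < \<delta> \<longrightarrow> \<bar>G x i - G y i\<bar> < \<eta>"
    using finite_common_uniform_continuity[of I ?Q "\<lambda>i x. G x i", OF \<open>finite I\<close> comp cont \<open>0 < \<eta>\<close>]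
    by auto
  \<comment> \<open>Corners of one grid cell differ by at most (b - a) / p in each coordinate, hence
    by at most twice that in the product metric.\<close>
  obtain p :: nat where p: "2 * (b - a) / \<delta> < real p"
    using reals_Archimedean2 by blast
  have "0 < p" using p \<open>a < b\<close> \<open>0 < \<delta>\<close> by (cases p) (auto simp: field_simps)
  define n where "n = card I"
  obtain e where e: "bij_betw e {..<n} I"
    using \<open>finite I\<close> by (metis ex_bij_betw_nat_finite lessThan_atLeast0 n_def)
  define X :: "(nat \<Rightarrow> nat) \<Rightarrow> 'i \<Rightarrow> real" where
    "X r i = (if i \<in> I then a + (b - a) * real (r (the_inv_into {..<n} e i)) / real p else 0)" for r i
  have e_inv: "the_inv_into {..<n} e (e j) = j" "e j \<in> I" if "j < n" for j
    using e that by (auto simp: bij_betw_def the_inv_into_f_f)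
  have inv_e: "the_inv_into {..<n} e i < n" "e (the_inv_into {..<n} e i) = i" if "i \<in> I" for i
    using e that the_inv_into_into[of e "{..<n}" i "{..<n}"] f_the_inv_into_f[of e "{..<n}" i]
    by (auto simp: bij_betw_def)
  have X_e: "X r (e j) = a + (b - a) * real (r j) / real p" if "j < n" for r j
    using e_inv[OF that] by (simp add: X_def)
  have X_in: "X r \<in> ?Q" if "\<forall>j<n. r j \<le> p" for r
  proof -
    have "X r i \<in> {a..b}" if "i \<in> I" for i
    proof -
      define t where "t = real (r (the_inv_into {..<n} e i)) / real p"
      have "0 \<le> t" "t \<le> 1"
        using inv_e(1)[OF \<open>i \<in> I\<close>] \<open>\<forall>j<n. r j \<le> p\<close> \<open>0 < p\<close> by (auto simp: t_def)
      moreover have "X r i = a + (b - a) * t" using that by (simp add: X_def t_def)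
      moreover have "(b - a) * t \<le> b - a"
        using \<open>a < b\<close> \<open>0 \<le> t\<close> \<open>t \<le> 1\<close> by (intro mult_left_le) auto
      moreover have "0 \<le> (b - a) * t" using \<open>a < b\<close> \<open>0 \<le> t\<close> by simp
      ultimately show ?thesis by simp
    qed
    then show ?thesis by (simp add: cube_def X_def)
  qed
  \<comment> \<open>On the faces the labels are forced, as \<open>kuhn_lemma\<close> demands;
    \<open>low\<close> and \<open>high\<close> make the forced values compatible with the sign of
    \<open>G\<close>. In between, a zero value receives label 0.\<close>
  define label :: "(nat \<Rightarrow> nat) \<Rightarrow> nat \<Rightarrow> nat" where
    "label r j = (if r j = 0 then 0 else if r j = p then 1 else if 0 < G (X r) (e j) then 1 else 0)"
    for r j
  have label0: "G (X r) (e j) \<le> 0" if "label r j = 0" "j < n" "\<forall>j<n. r j \<le> p" for r j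
  proof (cases "r j = 0")
    case True
    then show ?thesis
      using low[OF X_in[OF that(3)] e_inv(2)[OF that(2)]] that(2) by (simp add: X_e)
  next
    case False
    then show ?thesis using that(1) by (simp add: label_def split: if_splits)
  qed
  have label1: "0 \<le> G (X r) (e j)" if "label r j \<noteq> 0" "j < n" "\<forall>j<n. r j \<le> p" for r j
  proof (cases "r j = p")
    case True
    then show ?thesis
      using high[OF X_in[OF that(3)] e_inv(2)[OF that(2)]] that(2) \<open>0 < p\<close> by (simp add: X_e)
  next
    case False
    then show ?thesis using that(1) by (simp add: label_def split: if_splits)
  qed
  obtain q where q: "\<forall>i<n. q i < p"
    and rs: "\<forall>i<n. \<exists>r s. (\<forall>j<n. q j \<le> r j \<and> r j \<le> q j + 1) \<and>
      (\<forall>j<n. q j \<le> s j \<and> s j \<le> q j + 1) \<and> label r i \<noteq> label s i"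
  proof (rule kuhn_lemma[of p n label])
    show "\<forall>x. (\<forall>i<n. x i \<le> p) \<longrightarrow> (\<forall>i<n. x i = p \<longrightarrow> label x i = 1)"
      using \<open>0 < p\<close> by (simp add: label_def)
  qed (use \<open>0 < p\<close> in \<open>auto simp: label_def\<close>)
  have Xq: "X q \<in> ?Q" using q by (intro X_in) (auto intro: less_imp_le)
  have near: "X r \<in> ?Q \<and> (\<forall>j<n. r j \<le> p) \<and> (\<forall>i\<in>I. \<bar>G (X r) i - G (X q) i\<bar> < \<eta>)"
    if r: "\<forall>j<n. q j \<le> r j \<and> r j \<le> q j + 1" for r
  proof -
    have rp: "\<forall>j<n. r j \<le> p"
    proof (intro allI impI)
      fix j assume "j < n"
      then have "q j < p" "r j \<le> q j + 1" using q r by blast+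
      then show "r j \<le> p" by linarith
    qed
    have "dist (X r i) (X q i) \<le> (b - a) / real p" for i
    proof (cases "i \<in> I")
      case True
      define j where "j = the_inv_into {..<n} e i"
      have "j < n" using inv_e True by (simp add: j_def)
      then have "\<bar>real (r j) - real (q j)\<bar> \<le> 1" using r by force
      moreover have "X r i - X q i = (b - a) / real p * (real (r j) - real (q j))"
        using True
        by (simp add: X_def j_def algebra_simps add_divide_distrib diff_divide_distrib)
      ultimately show ?thesis
        using \<open>a < b\<close> by (simp add: dist_real_def abs_mult mult_left_le divide_right_mono)
    qed (use \<open>a < b\<close> in \<open>simp add: X_def\<close>)
    then have "dist (X r) (X q) \<le> 2 * ((b - a) / real p)" by (rule dist_fun_le)
    also have "\<dots> < \<delta>" using p \<open>0 < p\<close> \<open>0 < \<delta>\<close> by (simp add: field_simps)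
    finally show ?thesis using \<delta> X_in[OF rp] Xq rp by blast
  qed
  have small: "\<bar>G (X q) i\<bar> \<le> \<eta>" if "i \<in> I" for i
  proof -
    define j where "j = the_inv_into {..<n} e i"
    have j: "j < n" "e j = i" using inv_e[OF that] by (simp_all add: j_def)
    obtain r s where r: "\<forall>j<n. q j \<le> r j \<and> r j \<le> q j + 1"
      and s: "\<forall>j<n. q j \<le> s j \<and> s j \<le> q j + 1" and ne: "label r j \<noteq> label s j"
      using rs j by blast
    consider "label r j = 0" "label s j \<noteq> 0" | "label r j \<noteq> 0" "label s j = 0"
      using ne by (auto simp: label_def split: if_splits)
    then show ?thesis
    proof cases
      case 1
      then show ?thesis
        using near[OF r] near[OF s] label0[of r j] label1[of s j] j that by (auto simp: abs_le_iff)
    next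
      case 2
      then show ?thesis
        using near[OF r] near[OF s] label0[of s j] label1[of r j] j that by (auto simp: abs_le_iff)
    qed
  qed
  have "c \<le> (\<Sum>i\<in>I. \<bar>G (X q) i\<bar>)"
    using z(2)[OF Xq] by (simp add: c_def)
  also have "\<dots> \<le> (\<Sum>i\<in>I. \<eta>)" using small by (rule sum_mono)
  also have "\<dots> = c / 2" using N by (simp add: \<eta>_def)
  finally show False using \<open>0 < c\<close> by simp
qed

section \<open>Equivariant extension\<close>

text \<open>Rounding down q times the real and imaginary parts of the free entries, and q times t,
  sorts the points into small classes. Each free entry contributes two real dimensions and t
  one.\<close>

lemma box_dim_le_coordinate_cube:
  fixes E :: "('i::countable \<times> 'k::countable) set" and c :: "'i \<Rightarrow> 'k \<Rightarrow> complex"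
  assumes "finite E"
  shows "box_dim_le (2 * card E + 1)
    {(v, t::real). (\<forall>i k. if (i, k) \<in> E then cmod (v i k) \<le> 1 else v i k = c i k) \<and> t \<in> {0..1}}"
    (is "box_dim_le _ ?R")
  unfolding box_dim_le_def
\<comment> \<open>The (2q + 1)^2 labels per entry and the q + 1 for t are bounded by (3q)^2 and 2q.
  The diameter is 2/q per entry, doubled twice because a tuple is a function of functions, plus 1/q
  for t: in all 9/q.\<close>
proof (rule exI[of _ "3 ^ (2 * card E) * 2"], rule exI[of _ 9], intro allI impI)
  fix q :: nat assume "1 \<le> q"
  define \<psi> :: "('i \<Rightarrow> 'k \<Rightarrow> complex) \<times> real \<Rightarrow> ('i \<times> 'k \<Rightarrow> int \<times> int) \<times> int" where
    "\<psi> x = ((\<lambda>e\<in>E. (\<lfloor>real q * Re (fst x (fst e) (snd e))\<rfloor>,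
      \<lfloor>real q * Im (fst x (fst e) (snd e))\<rfloor>)), \<lfloor>real q * snd x\<rfloor>)" for x
  define Lab where "Lab = (E \<rightarrow>\<^sub>E ({- int q..int q} \<times> {- int q..int q})) \<times> {0..int q}"
  have "finite Lab"
    using assms by (auto simp: Lab_def intro!: finite_cartesian_product finite_PiE)
  have floor_in: "- int q \<le> \<lfloor>real q * r\<rfloor> \<and> \<lfloor>real q * r\<rfloor> \<le> int q" if "\<bar>r\<bar> \<le> 1" for r :: real
  proof -
    have "\<bar>real q * r\<bar> \<le> real q" using that by (simp add: abs_mult mult_left_le)
    then show ?thesis by (simp add: le_floor_iff floor_le_iff abs_le_iff)
  qed
  have \<psi>: "\<psi> x \<in> Lab" if "x \<in> ?R" for x
  proof -
    obtain v t where x: "x = (v, t)" by (cases x)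
    have "cmod (v (fst e) (snd e)) \<le> 1" if "e \<in> E" for e
      using \<open>x \<in> ?R\<close> that x by (cases e) (force split: if_splits)
    then have "\<bar>Re (v (fst e) (snd e))\<bar> \<le> 1" "\<bar>Im (v (fst e) (snd e))\<bar> \<le> 1" if "e \<in> E" for e
      using that abs_Re_le_cmod abs_Im_le_cmod order_trans by blast+
    moreover have "0 \<le> \<lfloor>real q * t\<rfloor>" "\<lfloor>real q * t\<rfloor> \<le> int q"
      using that x floor_in[of t] by auto
    ultimately show ?thesis
      using floor_in by (auto simp: x \<psi>_def Lab_def)
  qed
  have close: "\<bar>r - s\<bar> \<le> 1 / real q" if "\<lfloor>real q * r\<rfloor> = \<lfloor>real q * s\<rfloor>" for r s :: real
  proof -
    have "\<bar>real q * r - real q * s\<bar> \<le> 1" using that by linarith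
    then have "real q * \<bar>r - s\<bar> \<le> 1" by (simp add: abs_mult flip: right_diff_distrib)
    then show ?thesis using \<open>1 \<le> q\<close> by (simp add: field_simps)
  qed
  have small: "dist x y \<le> 9 / real q" if "x \<in> ?R" "y \<in> ?R" "\<psi> x = \<psi> y" for x y
  proof -
    obtain v t w s where xy: "x = (v, t)" "y = (w, s)" by (cases x, cases y)
    have "dist (v i k) (w i k) \<le> 2 / real q" for i k
    proof (cases "(i, k) \<in> E")
      case True
      have "fst (\<psi> x) (i, k) = fst (\<psi> y) (i, k)" using \<open>\<psi> x = \<psi> y\<close> by simp
      then have "\<lfloor>real q * Re (v i k)\<rfloor> = \<lfloor>real q * Re (w i k)\<rfloor>"
        "\<lfloor>real q * Im (v i k)\<rfloor> = \<lfloor>real q * Im (w i k)\<rfloor>"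
        by (simp_all add: \<psi>_def xy True)
      then have "\<bar>Re (v i k - w i k)\<bar> + \<bar>Im (v i k - w i k)\<bar> \<le> 1 / real q + 1 / real q"
        using close by (intro add_mono) auto
      then show ?thesis
        using cmod_le[of "v i k - w i k"] by (simp add: dist_norm)
    next
      case False
      then have "v i k = c i k" "w i k = c i k"
        using that(1,2) xy by (force split: if_splits)+
      then show ?thesis by simp
    qed
    then have "dist (v i) (w i) \<le> 2 * (2 / real q)" for i by (intro dist_fun_le)
    then have "dist v w \<le> 2 * (2 * (2 / real q))" by (rule dist_fun_le)
    moreover have "\<lfloor>real q * t\<rfloor> = \<lfloor>real q * s\<rfloor>"
      using \<open>\<psi> x = \<psi> y\<close> by (simp add: \<psi>_def xy)
    then have "dist t s \<le> 1 / real q" using close by (simp add: dist_real_def)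
    moreover have "dist x y \<le> dist v w + dist t s"
      by (simp add: xy dist_Pair_Pair sqrt_sum_squares_le_sum)
    ultimately show ?thesis by simp
  qed
  have "card Lab \<le> (3 ^ (2 * card E) * 2) * q ^ (2 * card E + 1)"
  proof -
    have "card Lab = ((2 * q + 1) * (2 * q + 1)) ^ card E * (q + 1)"
      using assms by (simp add: Lab_def card_cartesian_product card_PiE nat_add_distrib nat_mult_distrib)
    also have "\<dots> \<le> ((3 * q) * (3 * q)) ^ card E * (2 * q)"
      using \<open>1 \<le> q\<close> by (intro mult_mono power_mono) auto
    also have "\<dots> = (3 ^ (2 * card E) * 2) * q ^ (2 * card E + 1)"
      by (simp add: power_mult power_mult_distrib power2_eq_square)
    finally show ?thesis .
  qed
  moreover define R where "R = ?R"
  moreover define \<U> where "\<U> = (\<lambda>a. {x \<in> R. \<psi> x = a}) ` Lab"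
  ultimately have "card \<U> \<le> (3 ^ (2 * card E) * 2) * q ^ (2 * card E + 1)"
    using card_image_le[OF \<open>finite Lab\<close>] le_trans by blast
  moreover have "finite \<U>" using \<open>finite Lab\<close> by (simp add: \<U>_def)
  moreover have "R \<subseteq> \<Union>\<U>"
  proof
    fix x assume x: "x \<in> R"
    then have "\<psi> x \<in> Lab" unfolding R_def by (rule \<psi>)
    with x show "x \<in> \<Union>\<U>" by (auto simp: \<U>_def)
  qed
  moreover have "\<forall>U\<in>\<U>. \<forall>x\<in>U. \<forall>y\<in>U. dist x y \<le> 9 / real q"
  proof (intro ballI)
    fix U x y assume "U \<in> \<U>" "x \<in> U" "y \<in> U"
    then have "x \<in> R" "y \<in> R" "\<psi> x = \<psi> y" by (auto simp: \<U>_def)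
    then show "dist x y \<le> 9 / real q" unfolding R_def by (rule small)
  qed
  ultimately show "\<exists>\<U>. finite \<U> \<and> card \<U> \<le> (3 ^ (2 * card E) * 2) * q ^ (2 * card E + 1) \<and>
      ?R \<subseteq> \<Union>\<U> \<and> (\<forall>U\<in>\<U>. \<forall>x\<in>U. \<forall>y\<in>U. dist x y \<le> 9 / real q)"
    unfolding R_def by (intro exI[of _ \<U>] conjI)
qed

section \<open>Tuples, characters and slices for the scalar action\<close>

definition nonzero_tuples :: "nat \<Rightarrow> nat \<Rightarrow> (nat \<Rightarrow> nat \<Rightarrow> complex) set" where
  "nonzero_tuples n d = {v \<in> direct_sum n (\<lambda>i. d). \<forall>i\<in>{1..n}. v i \<noteq> (\<lambda>k. 0)}"

text \<open>The complexified torus. Positive real factors are included so that a vector can be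
  divided by its largest entry.\<close>

definition scalars :: "nat \<Rightarrow> (nat \<Rightarrow> complex) set" where
  "scalars n = {l. \<forall>i\<in>{1..n}. l i \<noteq> 0}"

text \<open>Component \<open>(i, k)\<close> with \<open>k < d - i\<close> belongs to \<open>f\<^sub>i\<close>, and with \<open>k > d - i\<close> to the inner
  product of \<open>v\<^sub>i\<close> and \<open>v\<^sub>j\<close> for \<open>j = d - k < i\<close>.\<close>

definition coords :: "nat \<Rightarrow> nat \<Rightarrow> (nat \<times> nat) set" where
  "coords n d = (SIGMA i:{1..n}. {..<d} - {d - i})"

text \<open>The character by which a component transforms; the conjugated factor comes from the
  second argument of the Hermitian product.\<close>

definition weight :: "nat \<Rightarrow> (nat \<Rightarrow> complex) \<Rightarrow> nat \<times> nat \<Rightarrow> complex" where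
  "weight d l = (\<lambda>(i, k). l i * (if d - i < k then cnj (l (d - k)) else 1))"

text \<open>Closedness is relative because tuples containing a zero vector are excluded. The real
  factor is a homotopy time, fixed by the action.\<close>

definition invariant_closed ::
  "nat \<Rightarrow> nat \<Rightarrow> ((nat \<Rightarrow> nat \<Rightarrow> complex) \<times> real) set \<Rightarrow> bool" where
  "invariant_closed n d A \<longleftrightarrow> closedin (top_of_set (nonzero_tuples n d \<times> UNIV)) A \<and>
    (\<forall>l\<in>scalars n. \<forall>v t. (v, t) \<in> A \<longrightarrow> (torus_act l v, t) \<in> A)"

text \<open>The flag \<open>nz\<close> lets the same gluing serve two extension problems: extending
  \<open>f\<close> off the orthogonal tuples, where zeros may appear, and constructing the homotopy,
  where they may not.\<close>

definition weighted_map :: "nat \<Rightarrow> nat \<Rightarrow> (nat \<times> nat) set \<Rightarrow> bool \<Rightarrow>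
    ((nat \<Rightarrow> nat \<Rightarrow> complex) \<times> real) set \<Rightarrow>
    ((nat \<Rightarrow> nat \<Rightarrow> complex) \<times> real \<Rightarrow> nat \<times> nat \<Rightarrow> complex) \<Rightarrow> bool" where
  "weighted_map n d J nz A F \<longleftrightarrow>
    (\<forall>j\<in>J. continuous_on A (\<lambda>x. F x j)) \<and>
    (\<forall>l\<in>scalars n. \<forall>v t. (v, t) \<in> A \<longrightarrow> (\<forall>j\<in>J. F (torus_act l v, t) j = weight d l j * F (v, t) j)) \<and>
    (nz \<longrightarrow> (\<forall>x\<in>A. \<exists>j\<in>J. F x j \<noteq> 0))"

text \<open>A closed polydisc in a standard affine chart of the product of projective spaces,
  realised as a slice for the scalar action.\<close>

definition chart :: "nat \<Rightarrow> nat \<Rightarrow> (nat \<Rightarrow> nat) \<Rightarrow> (nat \<Rightarrow> nat \<Rightarrow> complex) set" where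
  "chart n d m = {v \<in> nonzero_tuples n d. \<forall>i\<in>{1..n}. v i (m i) = 1 \<and> (\<forall>k. cmod (v i k) \<le> 1)}"

text \<open>The saturation of \<open>chart n d m\<close> under \<open>scalars n\<close>; finitely
  many of these sets cover all nonzero tuples.\<close>

definition dominated :: "nat \<Rightarrow> nat \<Rightarrow> (nat \<Rightarrow> nat) \<Rightarrow> (nat \<Rightarrow> nat \<Rightarrow> complex) set" where
  "dominated n d m = {v \<in> nonzero_tuples n d. \<forall>i\<in>{1..n}. \<forall>k. cmod (v i k) \<le> cmod (v i (m i))}"

definition extends_from_closed :: "'j set \<Rightarrow> bool \<Rightarrow> 'a::topological_space set \<Rightarrow> bool" where
  "extends_from_closed J nz Q \<longleftrightarrow>
    (\<forall>C (f :: 'a \<Rightarrow> 'j \<Rightarrow> complex).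
      closedin (top_of_set Q) C \<and> (\<forall>j\<in>J. continuous_on C (\<lambda>x. f x j)) \<and>
      (nz \<longrightarrow> (\<forall>x\<in>C. \<exists>j\<in>J. f x j \<noteq> 0)) \<longrightarrow>
      (\<exists>h. (\<forall>j\<in>J. continuous_on Q (\<lambda>x. h x j)) \<and> (\<forall>j\<in>J. \<forall>x\<in>C. h x j = f x j) \<and>
        (nz \<longrightarrow> (\<forall>x\<in>Q. \<exists>j\<in>J. h x j \<noteq> 0))))"

lemma weight_mult: "weight d (\<lambda>i. a i * b i) j = weight d a j * weight d b j"
  by (auto simp: weight_def split: prod.splits)

lemma weight_nonzero: "l \<in> scalars n \<Longrightarrow> j \<in> coords n d \<Longrightarrow> weight d l j \<noteq> 0"
proof -
  assume l: "l \<in> scalars n" and j: "j \<in> coords n d"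
  obtain i k where [simp]: "j = (i, k)" by (cases j)
  have "i \<in> {1..n}" "d - i < k \<Longrightarrow> d - k \<in> {1..n}" using j by (auto simp: coords_def)
  then show ?thesis using l by (auto simp: weight_def scalars_def)
qed

lemma weight_one:
  assumes "\<And>i. i \<in> {1..n} \<Longrightarrow> l i = 1" "j \<in> coords n d"
  shows "weight d l j = 1"
proof -
  obtain i k where [simp]: "j = (i, k)" by (cases j)
  have "i \<in> {1..n}" "d - i < k \<Longrightarrow> d - k \<in> {1..n}" using assms(2) by (auto simp: coords_def)
  then have "l i = 1" "d - i < k \<Longrightarrow> l (d - k) = 1" using assms(1) by blast+
  then show ?thesis by (simp add: weight_def)
qed

lemma torus_act_nonzero_tuples:
  assumes "l \<in> scalars n" "v \<in> nonzero_tuples n d"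
  shows "torus_act l v \<in> nonzero_tuples n d"
proof -
  have "torus_act l v i \<noteq> (\<lambda>k. 0)" if i: "i \<in> {1..n}" for i
  proof -
    have "v i \<noteq> (\<lambda>k. 0)" using assms(2) i by (simp add: nonzero_tuples_def)
    then obtain k where "v i k \<noteq> 0" by (meson ext)
    moreover have "l i \<noteq> 0" using assms(1) i by (simp add: scalars_def)
    ultimately show ?thesis by (auto simp: torus_act_def dest: fun_cong[of _ _ k])
  qed
  moreover have "torus_act l v \<in> direct_sum n (\<lambda>i. d)"
    using assms(2) by (simp add: nonzero_tuples_def direct_sum_def complex_space_def torus_act_def)
  ultimately show ?thesis by (simp add: nonzero_tuples_def)
qed

lemma continuous_on_fst_entry [continuous_intros]:
  fixes f :: "'a::topological_space \<Rightarrow> ('i \<Rightarrow> 'k \<Rightarrow> 'c::topological_space) \<times> 'b::topological_space"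
  assumes "continuous_on A f"
  shows "continuous_on A (\<lambda>x. fst (f x) i k)"
  by (rule continuous_on_product_then_coordinatewise,
      rule continuous_on_product_then_coordinatewise, rule continuous_on_fst, rule assms)

lemma continuous_on_weight:
  assumes "\<And>i. continuous_on A (\<lambda>x. l x i)"
  shows "continuous_on A (\<lambda>x. weight d (l x) j)"
proof -
  obtain i k where "j = (i, k)" by (cases j)
  then show ?thesis
    using continuous_on_mult[OF assms continuous_on_cnj[OF assms], of i "d - k"] assms[of i]
    by (cases "d - i < k") (simp_all add: weight_def)
qed

lemma dominated_nonzero:
  assumes "v \<in> dominated n d m" "i \<in> {1..n}"
  shows "v i (m i) \<noteq> 0"
proof
  assume "v i (m i) = 0"
  then have "cmod (v i k) \<le> 0" for k
    using assms \<open>v i (m i) = 0\<close> by (force simp: dominated_def)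
  then have "v i = (\<lambda>k. 0)" by (simp add: fun_eq_iff)
  then show False using assms by (simp add: dominated_def nonzero_tuples_def)
qed

text \<open>Dividing row i by its entry at \<open>m i\<close> moves a dominated tuple to the only
  point of its orbit in the chart. Values on the chart can therefore be chosen freely, subject to
  those already given on \<open>A\<close>, and the weights carry them along the orbits; on the
  overlap with \<open>A\<close> both prescriptions agree by equivariance.\<close>

lemma weighted_extension_step:
  assumes J: "J \<subseteq> coords n d"
    and A: "invariant_closed n d A" and B: "invariant_closed n d B"
    and F: "weighted_map n d J nz A F"
    and ex_ext: "extends_from_closed J nz (B \<inter> chart n d m \<times> UNIV)"
  shows "\<exists>F'. weighted_map n d J nz (A \<union> (B \<inter> dominated n d m \<times> UNIV)) F' \<and> (\<forall>x\<in>A. F' x = F x)"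
    and "invariant_closed n d (A \<union> (B \<inter> dominated n d m \<times> UNIV))"
proof -
  let ?X = "nonzero_tuples n d \<times> (UNIV :: real set)"
  define Q where "Q = B \<inter> chart n d m \<times> UNIV"
  define E where "E = B \<inter> dominated n d m \<times> UNIV"
  define \<rho> :: "(nat \<Rightarrow> nat \<Rightarrow> complex) \<times> real \<Rightarrow> (nat \<Rightarrow> nat \<Rightarrow> complex) \<times> real"
    where "\<rho> x = (torus_act (\<lambda>i. inverse (fst x i (m i))) (fst x), snd x)" for x
  have Acl: "closedin (top_of_set ?X) A" and Bcl: "closedin (top_of_set ?X) B"
    using A B by (auto simp: invariant_closed_def)
  have inv: "(torus_act l v, t) \<in> A" if "(v, t) \<in> A" "l \<in> scalars n" for l v t
    using A that by (auto simp: invariant_closed_def)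
  have invB: "(torus_act l v, t) \<in> B" if "(v, t) \<in> B" "l \<in> scalars n" for l v t
    using B that by (auto simp: invariant_closed_def)
  have dominated_act: "torus_act l v \<in> dominated n d m" if "v \<in> dominated n d m" "l \<in> scalars n" for l v
    using that torus_act_nonzero_tuples[of l n v d]
    by (auto simp: dominated_def torus_act_def norm_mult mult_left_mono)
  have invE: "(torus_act l v, t) \<in> E" if "(v, t) \<in> E" "l \<in> scalars n" for l v t
    using that invB dominated_act by (auto simp: E_def)
  have "closed {x :: (nat \<Rightarrow> nat \<Rightarrow> complex) \<times> real. \<forall>i\<in>{1..n}. \<forall>k. cmod (fst x i k) \<le> cmod (fst x i (m i))}"
    unfolding Ball_def
    by (intro closed_Collect_all closed_Collect_imp closed_Collect_le open_Collect_const continuous_intros)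
  then have "closedin (top_of_set ?X) (?X \<inter> {x. \<forall>i\<in>{1..n}. \<forall>k. cmod (fst x i k) \<le> cmod (fst x i (m i))})"
    by (rule closedin_closed_Int)
  moreover have "?X \<inter> {x. \<forall>i\<in>{1..n}. \<forall>k. cmod (fst x i k) \<le> cmod (fst x i (m i))} = dominated n d m \<times> UNIV"
    by (auto simp: dominated_def)
  ultimately have Ecl: "closedin (top_of_set ?X) E"
    unfolding E_def using Bcl by (auto intro: closedin_Int)
  have scal: "(\<lambda>i. fst x i (m i)) \<in> scalars n" if "x \<in> E" for x
    using that dominated_nonzero by (force simp: E_def scalars_def)
  have scal': "(\<lambda>i. inverse (fst x i (m i))) \<in> scalars n" if "x \<in> E" for x
    using scal[OF that] by (simp add: scalars_def)
  have \<rho>Q: "\<rho> x \<in> Q" if "x \<in> E" for x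
  proof -
    obtain v t where x: "x = (v, t)" by (cases x)
    have v: "v \<in> dominated n d m" using that x by (simp add: E_def)
    have "torus_act (\<lambda>i. inverse (v i (m i))) v \<in> nonzero_tuples n d"
      using v scal'[OF that] x by (intro torus_act_nonzero_tuples) (auto simp: dominated_def)
    moreover have "cmod (inverse (v i (m i)) * v i k) \<le> 1" if "i \<in> {1..n}" for i k
    proof -
      have "cmod (v i k) \<le> cmod (v i (m i))" using v that by (simp add: dominated_def)
      then show ?thesis
        using dominated_nonzero[OF v that] by (simp add: norm_divide field_simps)
    qed
    ultimately have "torus_act (\<lambda>i. inverse (v i (m i))) v \<in> chart n d m"
      using dominated_nonzero[OF v] by (simp add: chart_def torus_act_def)
    then show ?thesis
      using that scal'[OF that] invB by (auto simp: Q_def E_def \<rho>_def x)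
  qed
  have \<rho>_act: "\<rho> (torus_act l v, t) = \<rho> (v, t)" if "l \<in> scalars n" "(v, t) \<in> E" for l v t
  proof -
    have "inverse (l i * v i (m i)) * (l i * v i k) = inverse (v i (m i)) * v i k" for i k
    proof (cases "i \<in> {1..n}")
      case True
      then show ?thesis using that by (simp add: scalars_def)
    next
      case False
      then have "v i k = 0" using that by (auto simp: E_def dominated_def nonzero_tuples_def direct_sum_def)
      then show ?thesis by simp
    qed
    then show ?thesis by (simp only: \<rho>_def torus_act_def fst_conv snd_conv)
  qed
  have F1: "\<And>j. j \<in> J \<Longrightarrow> continuous_on A (\<lambda>x. F x j)"
    and F2: "\<And>l v t j. l \<in> scalars n \<Longrightarrow> (v, t) \<in> A \<Longrightarrow> j \<in> J \<Longrightarrow>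
      F (torus_act l v, t) j = weight d l j * F (v, t) j"
    and F3: "nz \<Longrightarrow> \<forall>x\<in>A. \<exists>j\<in>J. F x j \<noteq> 0"
    using F by (auto simp: weighted_map_def)
  have "closedin (top_of_set Q) (A \<inter> Q)"
  proof -
    have "Q \<subseteq> ?X" by (auto simp: Q_def chart_def)
    moreover obtain T where "closed T" "A = ?X \<inter> T"
      using Acl unfolding closedin_closed by blast
    ultimately have "A \<inter> Q = Q \<inter> T" by blast
    then show ?thesis using \<open>closed T\<close> closedin_closed by blast
  qed
  moreover have "\<forall>j\<in>J. continuous_on (A \<inter> Q) (\<lambda>x. F x j)"
    using F1 by (auto intro: continuous_on_subset)
  moreover have "nz \<longrightarrow> (\<forall>x\<in>A \<inter> Q. \<exists>j\<in>J. F x j \<noteq> 0)" using F3 by blast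
  ultimately have "\<exists>h. (\<forall>j\<in>J. continuous_on Q (\<lambda>x. h x j)) \<and> (\<forall>j\<in>J. \<forall>x\<in>A \<inter> Q. h x j = F x j) \<and>
      (nz \<longrightarrow> (\<forall>x\<in>Q. \<exists>j\<in>J. h x j \<noteq> 0))"
    using ex_ext[folded Q_def, unfolded extends_from_closed_def, rule_format, of "A \<inter> Q" F] by simp
  then obtain h where h1: "\<forall>j\<in>J. continuous_on Q (\<lambda>x. h x j)"
    and h2: "\<forall>j\<in>J. \<forall>x\<in>A \<inter> Q. h x j = F x j" and h3: "nz \<longrightarrow> (\<forall>x\<in>Q. \<exists>j\<in>J. h x j \<noteq> 0)"
    by (elim exE conjE)
  \<comment> \<open>Undoes the normalisation: \<open>x\<close> arises from \<open>\<rho> x\<close>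
    by acting with the entries at \<open>m i\<close>, so equivariance forces the factor to be the
    weight of these entries.\<close>
  define G where "G x j = weight d (\<lambda>i. fst x i (m i)) j * h (\<rho> x) j" for x j
  have GF: "G x j = F x j" if "x \<in> A \<inter> E" "j \<in> J" for x j
  proof -
    have s: "(\<lambda>i. inverse (fst x i (m i))) \<in> scalars n" using scal' that by auto
    have "\<rho> x \<in> A" using inv[OF _ s, of "fst x" "snd x"] that by (simp add: \<rho>_def)
    then have "h (\<rho> x) j = F (\<rho> x) j" using h2 \<rho>Q that by auto
    also have "\<dots> = weight d (\<lambda>i. inverse (fst x i (m i))) j * F x j"
      using F2[OF s, of "fst x" "snd x" j] that by (simp add: \<rho>_def)
    finally have "G x j = weight d (\<lambda>i. fst x i (m i) * inverse (fst x i (m i))) j * F x j"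
      by (simp add: G_def weight_mult)
    moreover have "weight d (\<lambda>i. fst x i (m i) * inverse (fst x i (m i))) j = 1"
      using scal[of x] that J by (intro weight_one[of n]) (auto simp: scalars_def)
    ultimately show ?thesis by simp
  qed
  have Gact: "G (torus_act l v, t) j = weight d l j * G (v, t) j" if "l \<in> scalars n" "(v, t) \<in> E" for l v t j
    using \<rho>_act[OF that] by (simp add: G_def torus_act_def weight_mult)
  have "continuous_on E \<rho>"
  proof -
    have "continuous_on E (\<lambda>x. inverse (fst x i (m i)) * fst x i k)" for i k
    proof (cases "i \<in> {1..n}")
      case True
      then show ?thesis
        using scal by (intro continuous_intros) (auto simp: scalars_def)
    next
      case False
      then have "fst x i k = 0" if "x \<in> E" for x
        using that by (auto simp: E_def dominated_def nonzero_tuples_def direct_sum_def)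
      then show ?thesis
        by (intro continuous_on_eq[OF continuous_on_const[of E 0]]) simp
    qed
    then show ?thesis
      unfolding \<rho>_def torus_act_def
      by (intro continuous_on_Pair continuous_on_coordinatewise_then_product continuous_on_snd continuous_on_id)
  qed
  then have cont\<rho>: "continuous_on E \<rho>" .
  have contG: "continuous_on E (\<lambda>x. G x j)" if "j \<in> J" for j
    unfolding G_def
  proof (rule continuous_on_mult)
    show "continuous_on E (\<lambda>x. weight d (\<lambda>i. fst x i (m i)) j)"
      by (intro continuous_on_weight continuous_on_fst_entry continuous_on_id)
    have "\<rho> ` E \<subseteq> Q" using \<rho>Q by blast
    then show "continuous_on E (\<lambda>x. h (\<rho> x) j)"
      using continuous_on_compose2[OF bspec[OF h1 that] cont\<rho>] by blast
  qed
  define F' where "F' x = (if x \<in> A then F x else G x)" for x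
  have F'E: "F' x j = G x j" if "x \<in> E" "j \<in> J" for x j
    using GF that by (auto simp: F'_def)
  have F'A: "F' x = F x" if "x \<in> A" for x using that by (simp add: F'_def)
  have sub: "A \<union> E \<subseteq> ?X"
    using closedin_imp_subset[OF Acl] closedin_imp_subset[OF Ecl] by (rule Un_least)
  have "continuous_on (A \<union> E) (\<lambda>x. F' x j)" if "j \<in> J" for j
  proof (rule continuous_on_Un_local)
    show "closedin (top_of_set (A \<union> E)) A" "closedin (top_of_set (A \<union> E)) E"
      using closedin_subset_trans[OF Acl _ sub] closedin_subset_trans[OF Ecl _ sub] by simp_all
    show "continuous_on A (\<lambda>x. F' x j)"
      using F1[OF that] F'A by (simp cong: continuous_on_cong)
    show "continuous_on E (\<lambda>x. F' x j)"
      using contG[OF that] F'E that by (simp cong: continuous_on_cong)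
  qed
  moreover have "F' (torus_act l v, t) j = weight d l j * F' (v, t) j"
    if "l \<in> scalars n" "(v, t) \<in> A \<union> E" "j \<in> J" for l v t j
  proof (cases "(v, t) \<in> A")
    case True
    then show ?thesis using that inv F2 by (simp add: F'A)
  next
    case False
    then have "(v, t) \<in> E" using that by auto
    then show ?thesis using that invE Gact by (simp add: F'E)
  qed
  moreover have "\<exists>j\<in>J. F' x j \<noteq> 0" if "nz" "x \<in> A \<union> E" for x
  proof (cases "x \<in> A")
    case True
    then show ?thesis using F3 that by (auto simp: F'A)
  next
    case False
    then have "x \<in> E" using that by auto
    then have "\<exists>j\<in>J. h (\<rho> x) j \<noteq> 0" using h3 \<rho>Q \<open>nz\<close> by blast
    then obtain j where "j \<in> J" "h (\<rho> x) j \<noteq> 0" by blast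
    then have "G x j \<noteq> 0"
      using weight_nonzero[OF scal[OF \<open>x \<in> E\<close>] subsetD[OF J \<open>j \<in> J\<close>]] by (simp add: G_def)
    then show ?thesis using F'E \<open>x \<in> E\<close> \<open>j \<in> J\<close> by auto
  qed
  ultimately have "weighted_map n d J nz (A \<union> E) F'"
    unfolding weighted_map_def by (intro conjI ballI allI impI)
  then show "\<exists>F'. weighted_map n d J nz (A \<union> (B \<inter> dominated n d m \<times> UNIV)) F' \<and> (\<forall>x\<in>A. F' x = F x)"
    using F'A unfolding E_def by (intro exI[of _ F'] conjI ballI)
  have "closedin (top_of_set ?X) (A \<union> E)" using Acl Ecl by (rule closedin_Un)
  moreover have "(torus_act l v, t) \<in> A \<union> E" if "l \<in> scalars n" "(v, t) \<in> A \<union> E" for l v t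
    using that inv invE by blast
  ultimately show "invariant_closed n d (A \<union> (B \<inter> dominated n d m \<times> UNIV))"
    unfolding E_def[symmetric] invariant_closed_def by (intro conjI ballI allI impI)
qed

text \<open>Pieces are added one at a time; after each step the domain is again relatively closed
  and invariant, as the next step requires.\<close>

lemma weighted_extension:
  assumes J: "J \<subseteq> coords n d" and "finite \<P>"
    and A: "invariant_closed n d A" and F: "weighted_map n d J nz A F"
    and B: "\<And>B m. (B, m) \<in> \<P> \<Longrightarrow> invariant_closed n d B"
    and ex_ext: "\<And>B m. (B, m) \<in> \<P> \<Longrightarrow> extends_from_closed J nz (B \<inter> chart n d m \<times> UNIV)"
  shows "\<exists>F'. weighted_map n d J nz (A \<union> (\<Union>(B, m)\<in>\<P>. B \<inter> dominated n d m \<times> UNIV)) F' \<and>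
    (\<forall>x\<in>A. F' x = F x)"
proof -
  have "\<exists>F'. weighted_map n d J nz (A \<union> (\<Union>(B, m)\<in>\<P>. B \<inter> dominated n d m \<times> UNIV)) F' \<and>
      (\<forall>x\<in>A. F' x = F x) \<and> invariant_closed n d (A \<union> (\<Union>(B, m)\<in>\<P>. B \<inter> dominated n d m \<times> UNIV))"
    using \<open>finite \<P>\<close> B ex_ext
  proof (induction \<P> rule: finite_induct)
    case empty
    then show ?case using A F by auto
  next
    case (insert p \<P>)
    obtain B m where p: "p = (B, m)" by (cases p)
    let ?A = "A \<union> (\<Union>(B, m)\<in>\<P>. B \<inter> dominated n d m \<times> UNIV)"
    have "\<exists>F'. weighted_map n d J nz ?A F' \<and> (\<forall>x\<in>A. F' x = F x) \<and> invariant_closed n d ?A"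
      by (rule insert.IH) (use insert.prems in \<open>blast+\<close>)
    then obtain F1 where F1: "weighted_map n d J nz ?A F1" "\<forall>x\<in>A. F1 x = F x" "invariant_closed n d ?A"
      by (elim exE conjE)
    have Bi: "invariant_closed n d B" using insert.prems(1) p by blast
    have "extends_from_closed J nz (B \<inter> chart n d m \<times> UNIV)" using insert.prems(2) p by blast
    note step = weighted_extension_step[OF J F1(3) Bi F1(1) this]
    have eq: "A \<union> (\<Union>(B, m)\<in>insert p \<P>. B \<inter> dominated n d m \<times> UNIV) = ?A \<union> (B \<inter> dominated n d m \<times> UNIV)"
      by (auto simp: p)
    obtain F2 where "weighted_map n d J nz (?A \<union> (B \<inter> dominated n d m \<times> UNIV)) F2" "\<forall>x\<in>?A. F2 x = F1 x"
      using step(1) p by auto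
    moreover have "invariant_closed n d (?A \<union> (B \<inter> dominated n d m \<times> UNIV))"
      using step(2) p by auto
    ultimately show ?case
      unfolding eq using F1(2) by (intro exI[of _ F2]) auto
  qed
  then obtain F' where "weighted_map n d J nz (A \<union> (\<Union>(B, m)\<in>\<P>. B \<inter> dominated n d m \<times> UNIV)) F'"
    "\<forall>x\<in>A. F' x = F x"
    by (elim exE conjE)
  then show ?thesis by (intro exI conjI)
qed

text \<open>\<open>m\<close> records the position of a largest entry in each vector.\<close>

lemma nonzero_tuples_subset_dominated:
  "nonzero_tuples n d \<subseteq> (\<Union>m\<in>{1..n} \<rightarrow>\<^sub>E {..<d}. dominated n d m)"
proof
  fix v assume v: "v \<in> nonzero_tuples n d"
  have "\<exists>m<d. \<forall>k. cmod (v i k) \<le> cmod (v i m)" if "i \<in> {1..n}" for i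
  proof -
    have zero: "v i k = 0" if "d \<le> k" for k
      using v \<open>i \<in> {1..n}\<close> that by (auto simp: nonzero_tuples_def direct_sum_def complex_space_def)
    have "v i \<noteq> (\<lambda>k. 0)" using v that by (auto simp: nonzero_tuples_def)
    then have "{..<d} \<noteq> {}" using zero by fastforce
    then have "Max ((\<lambda>k. cmod (v i k)) ` {..<d}) \<in> (\<lambda>k. cmod (v i k)) ` {..<d}"
      by (intro Max_in) auto
    then obtain m where "m < d" and m: "Max ((\<lambda>k. cmod (v i k)) ` {..<d}) = cmod (v i m)"
      by blast
    moreover have "cmod (v i k) \<le> cmod (v i m)" if "k < d" for k
      unfolding m[symmetric] using that by (intro Max_ge) auto
    moreover have "cmod (v i k) \<le> cmod (v i m)" if "d \<le> k" for k
      using zero[OF that] by simp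
    ultimately show ?thesis by (meson not_le)
  qed
  then obtain m where m: "\<And>i. i \<in> {1..n} \<Longrightarrow> m i < d \<and> (\<forall>k. cmod (v i k) \<le> cmod (v i (m i)))"
    by metis
  then have "v \<in> dominated n d (restrict m {1..n})" using v by (auto simp: dominated_def)
  moreover have "restrict m {1..n} \<in> {1..n} \<rightarrow>\<^sub>E {..<d}" using m by auto
  ultimately show "v \<in> (\<Union>m\<in>{1..n} \<rightarrow>\<^sub>E {..<d}. dominated n d m)" by blast
qed

lemma extends_from_closed_tietze:
  fixes Q :: "'a::{metric_space,second_countable_topology} set" and J :: "'j set"
  shows "extends_from_closed J False Q"
  unfolding extends_from_closed_def
proof (intro allI impI, elim conjE)
  fix C and f :: "'a \<Rightarrow> 'j \<Rightarrow> complex"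
  assume cl: "closedin (top_of_set Q) C" and cont: "\<forall>j\<in>J. continuous_on C (\<lambda>x. f x j)"
  have "\<forall>j\<in>J. \<exists>g. continuous_on Q g \<and> (\<forall>x\<in>C. g x = f x j)"
  proof
    fix j assume "j \<in> J"
    then have "continuous_on C (\<lambda>x. f x j)" using cont by blast
    then obtain g where "continuous_on Q g" "\<And>x. x \<in> C \<Longrightarrow> g x = f x j"
      using Tietze_unbounded[OF _ cl] by blast
    then show "\<exists>g. continuous_on Q g \<and> (\<forall>x\<in>C. g x = f x j)" by blast
  qed
  from bchoice[OF this] obtain g where "\<forall>j\<in>J. continuous_on Q (g j) \<and> (\<forall>x\<in>C. g j x = f x j)"
    by (elim exE)
  then show "\<exists>h. (\<forall>j\<in>J. continuous_on Q (\<lambda>x. h x j)) \<and> (\<forall>j\<in>J. \<forall>x\<in>C. h x j = f x j) \<and>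
      (False \<longrightarrow> (\<forall>x\<in>Q. \<exists>j\<in>J. h x j \<noteq> 0))"
    by (intro exI[of _ "\<lambda>x j. g j x"]) simp
qed

lemma extends_from_closed_low_dim:
  fixes Q :: "'a::{metric_space,second_countable_topology} set" and J :: "'j set"
  assumes "compact Q" "box_dim_le m Q" "finite J" "m < 2 * card J"
  shows "extends_from_closed J nz Q"
proof (cases nz)
  case True
  show ?thesis
    unfolding extends_from_closed_def
  proof (intro allI impI, elim conjE)
    fix C and f :: "'a \<Rightarrow> 'j \<Rightarrow> complex"
    assume cl: "closedin (top_of_set Q) C" and cont: "\<forall>j\<in>J. continuous_on C (\<lambda>x. f x j)"
      and nz: "nz \<longrightarrow> (\<forall>x\<in>C. \<exists>j\<in>J. f x j \<noteq> 0)"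
    have C: "C \<subseteq> Q" "closed C"
      using closedin_imp_subset[OF cl] closedin_compact[OF assms(1) cl] compact_imp_closed by auto
    have "\<exists>h. (\<forall>j\<in>J. continuous_on Q (\<lambda>x. h x j)) \<and> (\<forall>j\<in>J. \<forall>x\<in>C. h x j = f x j) \<and>
        (\<forall>x\<in>Q. \<exists>j\<in>J. h x j \<noteq> 0)"
      by (rule nonvanishing_extension[OF assms C(2) C(1)]) (use cont nz True in blast)+
    then show "\<exists>h. (\<forall>j\<in>J. continuous_on Q (\<lambda>x. h x j)) \<and> (\<forall>j\<in>J. \<forall>x\<in>C. h x j = f x j) \<and>
        (nz \<longrightarrow> (\<forall>x\<in>Q. \<exists>j\<in>J. h x j \<noteq> 0))"
      using True by simp
  qed
next
  case False
  then show ?thesis using extends_from_closed_tietze[of J Q] by simp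
qed

lemma compact_coordinate_cube:
  fixes E :: "('i::countable \<times> 'k::countable) set" and c :: "'i \<Rightarrow> 'k \<Rightarrow> complex"
  shows "compact {(v, t::real). (\<forall>i k. if (i, k) \<in> E then cmod (v i k) \<le> 1 else v i k = c i k) \<and> t \<in> {0..1}}"
proof -
  have "compact {v. \<forall>i. v i \<in> {w. \<forall>k. w k \<in> (if (i, k) \<in> E then cball 0 1 else {c i k})}}"
    by (intro compact_coordinatewise) auto
  then have "compact ({v. \<forall>i. v i \<in> {w. \<forall>k. w k \<in> (if (i, k) \<in> E then cball 0 1 else {c i k})}} \<times> {0..1::real})"
    by (rule compact_Times) simp
  moreover have "{v. \<forall>i. v i \<in> {w. \<forall>k. w k \<in> (if (i, k) \<in> E then cball 0 1 else {c i k})}} \<times> {0..1::real} =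
    {(v, t::real). (\<forall>i k. if (i, k) \<in> E then cmod (v i k) \<le> 1 else v i k = c i k) \<and> t \<in> {0..1}}"
    by (auto split: if_splits)
  ultimately show ?thesis by simp
qed

text \<open>Serves both for the free entries of a chart and, with \<open>m i = d - i\<close>, for
  \<open>coords\<close>: the source modulo scalars and the target have the same complex
  dimension.\<close>

lemma card_sigma_minus_one:
  assumes "\<And>i. i \<in> {1..n} \<Longrightarrow> m i < d"
  shows "card (SIGMA i:{1..n}. {..<d} - {m i}) = n * (d - 1)"
proof -
  have "card (SIGMA i:{1..n}. {..<d} - {m i}) = (\<Sum>i\<in>{1..n}. card ({..<d} - {m i}))"
    by (rule card_SigmaI) auto
  also have "\<dots> = (\<Sum>i\<in>{1..n}. d - 1)"
    using assms by (intro sum.cong) auto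
  finally show ?thesis by simp
qed

lemma finite_coords: "finite (coords n d)"
  by (simp add: coords_def)

section \<open>The homotopy to the model map\<close>

definition hyperplane :: "nat \<Rightarrow> nat \<Rightarrow> nat \<Rightarrow> (nat \<Rightarrow> nat \<Rightarrow> complex) set" where
  "hyperplane n d j = {v \<in> nonzero_tuples n d. v j (d - j) = 0}"

text \<open>If \<open>m j = d - j\<close>, the slice is empty, since one entry would be both 0 and
  1. Otherwise the hyperplane condition removes one more free entry, so that together with time the
  real dimension is at most 2 (n (d - 1) - 1) + 1, below the 2 n (d - 1) real components of the
  target.\<close>

lemma extends_from_hyperplane_chart:
  assumes j: "j \<in> {1..n}" and "n \<le> d" and m: "m \<in> {1..n} \<rightarrow>\<^sub>E {..<d}"
  shows "extends_from_closed (coords n d) nz (hyperplane n d j \<times> {0..1::real} \<inter> chart n d m \<times> UNIV)"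
    (is "extends_from_closed _ _ ?Q")
proof (cases "m j = d - j")
  case True
  have "?Q = {}"
  proof (rule equals0I)
    fix x assume "x \<in> ?Q"
    then have "fst x j (d - j) = 0" "fst x j (m j) = 1"
      using j by (auto simp: hyperplane_def chart_def)
    then show False using True by simp
  qed
  then show ?thesis
    unfolding extends_from_closed_def by auto
next
  case False
  define E where "E = (SIGMA i:{1..n}. {..<d} - {m i}) - {(j, d - j)}"
  define c :: "nat \<Rightarrow> nat \<Rightarrow> complex" where "c i k = (if i \<in> {1..n} \<and> k = m i then 1 else 0)" for i k
  have md: "m i < d" if "i \<in> {1..n}" for i using m that by auto
  have "(j, d - j) \<in> (SIGMA i:{1..n}. {..<d} - {m i})" using j False \<open>n \<le> d\<close> by auto
  moreover have "finite (SIGMA i:{1..n}. {..<d} - {m i})" by simp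
  ultimately have "card E < card (SIGMA i:{1..n}. {..<d} - {m i})" "finite E"
    unfolding E_def by (blast intro: card_Diff1_less)+
  then have cardE: "card E < n * (d - 1)" using card_sigma_minus_one[of n m d] md by simp
  have "card (coords n d) = n * (d - 1)"
    unfolding coords_def using j \<open>n \<le> d\<close> by (intro card_sigma_minus_one) auto
  then have card: "2 * card E + 1 < 2 * card (coords n d)" using cardE by simp
  have in_E: "(i, k) \<in> E \<longleftrightarrow> i \<in> {1..n} \<and> k < d \<and> k \<noteq> m i \<and> (i, k) \<noteq> (j, d - j)" for i k
    by (auto simp: E_def)
  have "?Q = {(v, t::real). (\<forall>i k. if (i, k) \<in> E then cmod (v i k) \<le> 1 else v i k = c i k) \<and> t \<in> {0..1}}"
    (is "_ = ?R")
  proof (intro equalityI subsetI)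
    fix x assume "x \<in> ?Q"
    then obtain v t where x: "x = (v, t)" and v: "v \<in> nonzero_tuples n d" "v j (d - j) = 0"
      "\<And>i. i \<in> {1..n} \<Longrightarrow> v i (m i) = 1" "\<And>i k. i \<in> {1..n} \<Longrightarrow> cmod (v i k) \<le> 1" and t: "t \<in> {0..1}"
      by (auto simp: hyperplane_def chart_def)
    have "if (i, k) \<in> E then cmod (v i k) \<le> 1 else v i k = c i k" for i k
    proof (cases "i \<in> {1..n}")
      case True
      have "v i k = 0" if "d \<le> k"
        using v(1) True that by (auto simp: nonzero_tuples_def direct_sum_def complex_space_def)
      then show ?thesis
        using True v md[OF True] False unfolding in_E c_def by (cases "k < d") auto
    next
      case i: False
      then have "v i k = 0" using v(1) by (simp add: nonzero_tuples_def direct_sum_def)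
      then show ?thesis using i unfolding in_E c_def by auto
    qed
    then show "x \<in> ?R" using t by (simp add: x)
  next
    fix x assume "x \<in> ?R"
    then obtain v t where x: "x = (v, t)"
      and v: "\<And>i k. if (i, k) \<in> E then cmod (v i k) \<le> 1 else v i k = c i k" and t: "t \<in> {0..1}"
      by auto
    have v1: "v i (m i) = 1" if "i \<in> {1..n}" for i
      using v[of i "m i"] that unfolding in_E c_def by simp
    have "v j (d - j) = 0"
      using v[of j "d - j"] False unfolding in_E c_def by simp
    moreover have "cmod (v i k) \<le> 1" for i k
      using v[of i k] unfolding c_def by (auto split: if_splits)
    moreover have "v i = (\<lambda>k. 0)" if "i \<notin> {1..n}" for i
      using v[of i] that unfolding in_E c_def by auto
    moreover have "v i k = 0" if "i \<in> {1..n}" "d \<le> k" for i k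
      using v[of i k] that md[OF that(1)] unfolding in_E c_def by auto
    moreover have "v i \<noteq> (\<lambda>k. 0)" if "i \<in> {1..n}" for i
      using v1[OF that] by auto
    ultimately show "x \<in> ?Q"
      using t v1
      by (simp add: x hyperplane_def chart_def nonzero_tuples_def direct_sum_def complex_space_def)
  qed
  then show ?thesis
    using extends_from_closed_low_dim[OF compact_coordinate_cube[of E c]
        box_dim_le_coordinate_cube[OF \<open>finite E\<close>] finite_coords card] by simp
qed

section \<open>The model map, its zeros and its equivariance\<close>

definition model_map :: "nat \<Rightarrow> (nat \<Rightarrow> nat \<Rightarrow> complex) \<Rightarrow> nat \<times> nat \<Rightarrow> complex" where
  "model_map d v = (\<lambda>(i, k). if d - i < k then v i k * cnj (v (d - k) k) else v i k)"

lemma model_map_torus_act: "model_map d (torus_act l v) j = weight d l j * model_map d v j"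
  by (cases j) (simp add: model_map_def weight_def torus_act_def)

text \<open>The zero equations are triangular. By strong induction on i, the entry of v_i at k > d -
  i vanishes because its cofactor is the entry at index k = d - (d - k) of the earlier vector number
  d - k, already known to be nonzero; entries at k < d - i vanish outright. So v_i, not being 0, has
  a nonzero entry at d - i, for every i.\<close>

lemma model_map_nonzero:
  assumes v: "v \<in> nonzero_tuples n d" and "n \<le> d" and z: "i \<in> {1..n}" "v i (d - i) = 0"
  shows "\<exists>j\<in>coords n d. model_map d v j \<noteq> 0"
proof (rule ccontr)
  assume contra: "\<not> ?thesis"
  have "v i (d - i) \<noteq> 0" if "i \<in> {1..n}" for i
    using that
  proof (induction i rule: less_induct)
    case (less i)
    have "v i k = 0" if "k \<noteq> d - i" for k
    proof (cases "k < d")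
      case True
      then have ik: "(i, k) \<in> coords n d" using less.prems that by (simp add: coords_def)
      then have zero: "model_map d v (i, k) = 0" using contra by blast
      show ?thesis
      proof (cases "d - i < k")
        case gt: True
        then have "d - k < i" "d - k \<in> {1..n}" "d - (d - k) = k" using True less.prems by auto
        then have "v (d - k) k \<noteq> 0" using less.IH[of "d - k"] by simp
        then show ?thesis using zero gt by (simp add: model_map_def)
      qed (use zero in \<open>simp add: model_map_def\<close>)
    next
      case False
      then show ?thesis
        using v less.prems by (simp add: nonzero_tuples_def direct_sum_def complex_space_def)
    qed
    moreover have "v i \<noteq> (\<lambda>k. 0)" using v less.prems by (simp add: nonzero_tuples_def)
    ultimately show ?case by (metis ext)
  qed
  then show False using z by blast
qed

lemma continuous_on_fst_apply [continuous_intros]: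
  "continuous_on A (\<lambda>x :: (nat \<Rightarrow> nat \<Rightarrow> complex) \<times> real. fst x i k)"
  by (intro continuous_on_fst_entry continuous_on_id)

lemma continuous_on_model_map:
  fixes A :: "((nat \<Rightarrow> nat \<Rightarrow> complex) \<times> real) set"
  shows "continuous_on A (\<lambda>x. model_map d (fst x) j)"
proof -
  obtain i k where "j = (i, k)" by (cases j)
  then show ?thesis
    by (cases "d - i < k") (auto simp: model_map_def intro!: continuous_intros)
qed

lemma hyperplane_torus_act:
  "l \<in> scalars n \<Longrightarrow> v \<in> hyperplane n d j \<Longrightarrow> torus_act l v \<in> hyperplane n d j"
  using torus_act_nonzero_tuples[of l n v d] by (simp add: hyperplane_def torus_act_def)

lemma invariant_closed_hyperplane:
  assumes "closed T"
  shows "invariant_closed n d (hyperplane n d j \<times> T)"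
proof -
  have "closed {x :: (nat \<Rightarrow> nat \<Rightarrow> complex) \<times> real. fst x j (d - j) = 0 \<and> snd x \<in> T}"
    using assms by (intro closed_Collect_conj closed_Collect_eq continuous_intros closed_vimage_snd[unfolded vimage_def])
  then have "closedin (top_of_set (nonzero_tuples n d \<times> UNIV))
      (nonzero_tuples n d \<times> UNIV \<inter> {x. fst x j (d - j) = 0 \<and> snd x \<in> T})"
    by (rule closedin_closed_Int)
  moreover have "nonzero_tuples n d \<times> UNIV \<inter> {x. fst x j (d - j) = 0 \<and> snd x \<in> T} = hyperplane n d j \<times> T"
    by (auto simp: hyperplane_def)
  ultimately show ?thesis
    using hyperplane_torus_act by (auto simp: invariant_closed_def)
qed

lemma invariant_closed_slice:
  assumes "closed T"
  shows "invariant_closed n d (nonzero_tuples n d \<times> T)"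
proof -
  have "closed (UNIV \<times> T :: ((nat \<Rightarrow> nat \<Rightarrow> complex) \<times> real) set)"
    using assms by (intro closed_Times) auto
  then have "closedin (top_of_set (nonzero_tuples n d \<times> UNIV)) (nonzero_tuples n d \<times> UNIV \<inter> UNIV \<times> T)"
    by (rule closedin_closed_Int)
  moreover have "nonzero_tuples n d \<times> UNIV \<inter> UNIV \<times> T = nonzero_tuples n d \<times> T"
    by auto
  ultimately show ?thesis
    using torus_act_nonzero_tuples by (auto simp: invariant_closed_def)
qed

lemma invariant_closed_Un:
  "invariant_closed n d A \<Longrightarrow> invariant_closed n d B \<Longrightarrow> invariant_closed n d (A \<union> B)"
  unfolding invariant_closed_def by (auto intro: closedin_Un)

lemma invariant_closed_UN:
  "finite I \<Longrightarrow> (\<And>i. i \<in> I \<Longrightarrow> invariant_closed n d (A i)) \<Longrightarrow> invariant_closed n d (\<Union>i\<in>I. A i)"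
  by (induction I rule: finite_induct) (simp_all add: invariant_closed_Un, simp add: invariant_closed_def)

text \<open>\<open>F\<close> is prescribed at time 0 and the model map at time 1 over the
  hyperplanes; the rest is filled in hyperplane by hyperplane and chart by chart. Time 0 is kept
  over all tuples because the interior of the cell lies outside the hyperplanes and is used at time
  0 only.\<close>

lemma homotopy_to_model_map:
  assumes "n \<le> d"
    and F: "weighted_map n d (coords n d) True (nonzero_tuples n d \<times> {0}) F"
  shows "\<exists>H. (\<forall>j\<in>coords n d. continuous_on
      (nonzero_tuples n d \<times> {0} \<union> (\<Union>i\<in>{1..n}. hyperplane n d i) \<times> {0..1::real}) (\<lambda>x. H x j)) \<and>
    (\<forall>x\<in>nonzero_tuples n d \<times> {0} \<union> (\<Union>i\<in>{1..n}. hyperplane n d i) \<times> {0..1}. \<exists>j\<in>coords n d. H x j \<noteq> 0) \<and>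
    (\<forall>v\<in>(\<Union>i\<in>{1..n}. hyperplane n d i). H (v, 1) = model_map d v)"
proof -
  let ?X = "nonzero_tuples n d" and ?J = "coords n d"
  define Y where "Y = (\<Union>i\<in>{1..n}. hyperplane n d i)"
  define A where "A = ?X \<times> {0::real} \<union> Y \<times> {1}"
  define F1 where "F1 x = (if snd x = 0 then F x else model_map d (fst x))" for x
  have Y1: "invariant_closed n d (Y \<times> {1})"
  proof -
    have "invariant_closed n d (\<Union>i\<in>{1..n}. hyperplane n d i \<times> {1})"
      by (intro invariant_closed_UN invariant_closed_hyperplane) auto
    moreover have "(\<Union>i\<in>{1..n}. hyperplane n d i \<times> {1::real}) = Y \<times> {1}" by (auto simp: Y_def)
    ultimately show ?thesis by simp
  qed
  have X0: "invariant_closed n d (?X \<times> {0})" by (rule invariant_closed_slice) simp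
  have A: "invariant_closed n d A" unfolding A_def using X0 Y1 by (rule invariant_closed_Un)
  have Y_sub: "Y \<subseteq> ?X" by (auto simp: Y_def hyperplane_def)
  have Y_act: "torus_act l v \<in> Y" if "l \<in> scalars n" "v \<in> Y" for l v
    using that hyperplane_torus_act unfolding Y_def by blast
  have F_1: "\<And>j. j \<in> ?J \<Longrightarrow> continuous_on (?X \<times> {0}) (\<lambda>x. F x j)"
    and F_2: "\<And>l v j. l \<in> scalars n \<Longrightarrow> v \<in> ?X \<Longrightarrow> j \<in> ?J \<Longrightarrow>
      F (torus_act l v, 0) j = weight d l j * F (v, 0) j"
    and F_3: "\<And>x. x \<in> ?X \<times> {0} \<Longrightarrow> \<exists>j\<in>?J. F x j \<noteq> 0"
    using F unfolding weighted_map_def by auto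
  have "weighted_map n d ?J True A F1"
    unfolding weighted_map_def
  proof (intro conjI ballI allI impI)
    fix j assume j: "j \<in> ?J"
    show "continuous_on A (\<lambda>x. F1 x j)"
      unfolding A_def
    proof (rule continuous_on_Un_local)
      have sub: "?X \<times> {0::real} \<union> Y \<times> {1} \<subseteq> ?X \<times> UNIV" using Y_sub by auto
      show "closedin (top_of_set (?X \<times> {0::real} \<union> Y \<times> {1})) (?X \<times> {0})"
        by (rule closedin_subset_trans[where U="?X \<times> UNIV", OF _ _ sub]) (use X0 in \<open>auto simp: invariant_closed_def\<close>)
      show "closedin (top_of_set (?X \<times> {0::real} \<union> Y \<times> {1})) (Y \<times> {1})"
        by (rule closedin_subset_trans[where U="?X \<times> UNIV", OF _ _ sub]) (use Y1 in \<open>auto simp: invariant_closed_def\<close>)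
      show "continuous_on (?X \<times> {0}) (\<lambda>x. F1 x j)"
        by (rule continuous_on_eq[OF F_1[OF j]]) (auto simp: F1_def)
      show "continuous_on (Y \<times> {1}) (\<lambda>x. F1 x j)"
        by (rule continuous_on_eq[OF continuous_on_model_map[of _ d j]]) (auto simp: F1_def)
    qed
  next
    fix l v t j assume "l \<in> scalars n" "(v, t) \<in> A" "j \<in> ?J"
    then show "F1 (torus_act l v, t) j = weight d l j * F1 (v, t) j"
      using F_2[of l v j] model_map_torus_act[of d l v j] by (auto simp: F1_def A_def)
  next
    fix x assume "x \<in> A"
    then consider "x \<in> ?X \<times> {0}" | v where "x = (v, 1)" "v \<in> Y" unfolding A_def by blast
    then show "\<exists>j\<in>?J. F1 x j \<noteq> 0"
    proof cases
      case 1
      then show ?thesis using F_3[OF 1] by (auto simp: F1_def)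
    next
      case 2
      then show ?thesis
        using model_map_nonzero[of v n d] \<open>n \<le> d\<close> by (auto simp: F1_def Y_def hyperplane_def)
    qed
  qed
  define \<P> where "\<P> = (\<lambda>(i, m). (hyperplane n d i \<times> {0..1::real}, m)) ` ({1..n} \<times> ({1..n} \<rightarrow>\<^sub>E {..<d}))"
  have P: "\<exists>i\<in>{1..n}. B = hyperplane n d i \<times> {0..1} \<and> m \<in> {1..n} \<rightarrow>\<^sub>E {..<d}" if "(B, m) \<in> \<P>" for B m
    using that by (auto simp: \<P>_def)
  have "\<exists>H. weighted_map n d ?J True (A \<union> (\<Union>(B, m)\<in>\<P>. B \<inter> dominated n d m \<times> UNIV)) H \<and>
      (\<forall>x\<in>A. H x = F1 x)"
  proof (rule weighted_extension)
    show "finite \<P>" unfolding \<P>_def by (intro finite_imageI finite_cartesian_product finite_PiE) auto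
    show "invariant_closed n d B" if "(B, m) \<in> \<P>" for B m
      using P[OF that] invariant_closed_hyperplane[of "{0..1}"] by auto
    show "extends_from_closed ?J True (B \<inter> chart n d m \<times> UNIV)" if "(B, m) \<in> \<P>" for B m
      using P[OF that] extends_from_hyperplane_chart[OF _ \<open>n \<le> d\<close>] by auto
  qed (use A \<open>weighted_map n d ?J True A F1\<close> in auto)
  then obtain H where H: "weighted_map n d ?J True (A \<union> (\<Union>(B, m)\<in>\<P>. B \<inter> dominated n d m \<times> UNIV)) H"
    and HA: "\<forall>x\<in>A. H x = F1 x"
    by (elim exE conjE)
  have sub: "?X \<times> {0::real} \<union> Y \<times> {0..1} \<subseteq> A \<union> (\<Union>(B, m)\<in>\<P>. B \<inter> dominated n d m \<times> UNIV)"
  proof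
    fix x assume "x \<in> ?X \<times> {0::real} \<union> Y \<times> {0..1}"
    then consider "x \<in> ?X \<times> {0::real}" | "x \<in> Y \<times> {0..1}" by blast
    then show "x \<in> A \<union> (\<Union>(B, m)\<in>\<P>. B \<inter> dominated n d m \<times> UNIV)"
    proof cases
      case 1
      then show ?thesis by (simp add: A_def)
    next
      case 2
      then obtain i where i: "i \<in> {1..n}" "x \<in> hyperplane n d i \<times> {0..1}" unfolding Y_def by blast
      have "fst x \<in> ?X" using 2 Y_sub by auto
      then obtain m where m: "m \<in> {1..n} \<rightarrow>\<^sub>E {..<d}" "fst x \<in> dominated n d m"
        using nonzero_tuples_subset_dominated by blast
      have "(hyperplane n d i \<times> {0..1}, m) \<in> \<P>" using i m by (auto simp: \<P>_def)
      moreover have "x \<in> hyperplane n d i \<times> {0..1} \<inter> dominated n d m \<times> UNIV"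
        using i(2) m(2) by (cases x) auto
      ultimately show ?thesis by blast
    qed
  qed
  have H_1: "\<And>j. j \<in> ?J \<Longrightarrow> continuous_on (A \<union> (\<Union>(B, m)\<in>\<P>. B \<inter> dominated n d m \<times> UNIV)) (\<lambda>x. H x j)"
    and H_3: "\<And>x. x \<in> A \<union> (\<Union>(B, m)\<in>\<P>. B \<inter> dominated n d m \<times> UNIV) \<Longrightarrow> \<exists>j\<in>?J. H x j \<noteq> 0"
    using H unfolding weighted_map_def by simp_all
  show ?thesis
    unfolding Y_def[symmetric]
  proof (intro exI[of _ H] conjI ballI)
    show "continuous_on (?X \<times> {0} \<union> Y \<times> {0..1}) (\<lambda>x. H x j)" if "j \<in> ?J" for j
      using continuous_on_subset[OF H_1[OF that] sub] .
    show "\<exists>j\<in>?J. H x j \<noteq> 0" if "x \<in> ?X \<times> {0} \<union> Y \<times> {0..1}" for x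
      using H_3[OF subsetD[OF sub that]] .
    show "H (v, 1) = model_map d v" if "v \<in> Y" for v
      using HA that by (auto simp: A_def F1_def)
  qed
qed

section \<open>The open cell\<close>

definition clamp1 :: "real \<Rightarrow> real" where
  "clamp1 r = max (- 1) (min 1 r)"

text \<open>The pivot vanishes exactly on the boundary of the cube of side 2, which is thereby mapped into
  the hyperplanes. Real and imaginary parts are indexed by \<open>True\<close> and \<open>False\<close>; the collar outside
  this cube, up to side 4, carries the homotopy.\<close>

definition cell_entry :: "(((nat \<times> nat) \<times> bool) \<Rightarrow> real) \<Rightarrow> nat \<times> nat \<Rightarrow> complex" where
  "cell_entry u p = Complex (clamp1 (u (p, True))) (clamp1 (u (p, False)))"

definition cell_pivot :: "nat \<Rightarrow> nat \<Rightarrow> (((nat \<times> nat) \<times> bool) \<Rightarrow> real) \<Rightarrow> nat \<Rightarrow> real" where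
  "cell_pivot n d u i =
    (\<Prod>c\<in>{c \<in> coords n d \<times> UNIV. fst (fst c) = i}. 1 - (clamp1 (u c))\<^sup>2)"

definition cell_map :: "nat \<Rightarrow> nat \<Rightarrow> (((nat \<times> nat) \<times> bool) \<Rightarrow> real) \<Rightarrow> nat \<Rightarrow> nat \<Rightarrow> complex" where
  "cell_map n d u = (\<lambda>i k. if (i, k) \<in> coords n d then cell_entry u (i, k)
    else if i \<in> {1..n} \<and> k = d - i then of_real (cell_pivot n d u i) else 0)"

text \<open>The product form gives 0 while no coordinate exceeds 1 in absolute value, and 1 as soon
  as a single one has absolute value 2, so that every outer face sits at the end of the
  homotopy.\<close>

definition collar_time :: "nat \<Rightarrow> nat \<Rightarrow> (((nat \<times> nat) \<times> bool) \<Rightarrow> real) \<Rightarrow> real" where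
  "collar_time n d u = 1 - (\<Prod>c\<in>coords n d \<times> UNIV. 1 - max 0 (\<bar>u c\<bar> - 1))"

section \<open>Boundary behaviour of the cell map and the collar\<close>

lemma clamp1_sq: "(clamp1 r)\<^sup>2 \<le> 1"
  using abs_square_le_1[of "clamp1 r"] by (simp add: clamp1_def abs_le_iff)

lemma cell_pivot_nonneg: "0 \<le> cell_pivot n d u i"
  unfolding cell_pivot_def using clamp1_sq by (intro prod_nonneg) auto

lemma cell_pivot_zero_iff:
  "cell_pivot n d u i = 0 \<longleftrightarrow> (\<exists>k b. (i, k) \<in> coords n d \<and> (clamp1 (u ((i, k), b)))\<^sup>2 = 1)"
proof -
  have "finite {c \<in> coords n d \<times> (UNIV :: bool set). fst (fst c) = i}"
    using finite_coords by simp
  then show ?thesis unfolding cell_pivot_def by (auto simp: prod_zero_iff)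
qed

text \<open>A vanishing pivot means that some real or imaginary part in the row is 1 or -1, so the
  row keeps a nonzero entry.\<close>

lemma cell_map_nonzero_tuples:
  assumes "n \<le> d"
  shows "cell_map n d u \<in> nonzero_tuples n d"
proof -
  have "cell_map n d u i \<noteq> (\<lambda>k. 0)" if i: "i \<in> {1..n}" for i
  proof (cases "cell_pivot n d u i = 0")
    case True
    then obtain k b where k: "(i, k) \<in> coords n d" and "(clamp1 (u ((i, k), b)))\<^sup>2 = 1"
      unfolding cell_pivot_zero_iff by blast
    then have "cell_entry u (i, k) \<noteq> 0"
      by (cases b) (auto simp: cell_entry_def complex_eq_iff)
    then show ?thesis using k by (auto simp: cell_map_def dest: fun_cong[of _ _ k])
  next
    case False
    have "(i, d - i) \<notin> coords n d" by (simp add: coords_def)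
    then show ?thesis using False i by (auto simp: cell_map_def dest: fun_cong[of _ _ "d - i"])
  qed
  moreover have "cell_map n d u i k = 0" if "i \<notin> {1..n} \<or> d \<le> k" for i k
    using that assms by (auto simp: cell_map_def coords_def)
  ultimately show ?thesis
    by (auto simp: nonzero_tuples_def direct_sum_def complex_space_def)
qed

lemma cell_map_hyperplane:
  assumes "n \<le> d" "c \<in> coords n d \<times> UNIV" "1 \<le> \<bar>u c\<bar>"
  shows "cell_map n d u \<in> (\<Union>i\<in>{1..n}. hyperplane n d i)"
proof -
  obtain i k b where c: "c = ((i, k), b)" by (metis surj_pair)
  have "clamp1 (u c) = 1 \<or> clamp1 (u c) = - 1" using assms(3) by (auto simp: clamp1_def)
  then have "(clamp1 (u ((i, k), b)))\<^sup>2 = 1" by (auto simp: c)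
  then have "cell_pivot n d u i = 0" using assms(2) c unfolding cell_pivot_zero_iff by auto
  moreover have "i \<in> {1..n}" using assms(2) c by (auto simp: coords_def)
  moreover have "(i, d - i) \<notin> coords n d" by (simp add: coords_def)
  ultimately have "cell_map n d u \<in> hyperplane n d i"
    using cell_map_nonzero_tuples[OF assms(1)] by (simp add: hyperplane_def cell_map_def)
  then show ?thesis using \<open>i \<in> {1..n}\<close> by blast
qed

lemma collar_time_bounds:
  assumes "\<And>c. c \<in> coords n d \<times> UNIV \<Longrightarrow> \<bar>u c\<bar> \<le> 2"
  shows "collar_time n d u \<in> {0..1}"
proof -
  have "0 \<le> (\<Prod>c\<in>coords n d \<times> (UNIV::bool set). 1 - max 0 (\<bar>u c\<bar> - 1))"
    using assms by (intro prod_nonneg) force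
  moreover have "(\<Prod>c\<in>coords n d \<times> (UNIV::bool set). 1 - max 0 (\<bar>u c\<bar> - 1)) \<le> 1"
    using assms by (intro prod_le_1) force
  ultimately show ?thesis by (simp add: collar_time_def)
qed

lemma collar_time_zero:
  assumes "\<And>c. c \<in> coords n d \<times> UNIV \<Longrightarrow> \<bar>u c\<bar> \<le> 1"
  shows "collar_time n d u = 0"
proof -
  have "(\<Prod>c\<in>coords n d \<times> (UNIV::bool set). 1 - max 0 (\<bar>u c\<bar> - 1)) = (\<Prod>c\<in>coords n d \<times> (UNIV::bool set). 1)"
  proof (rule prod.cong)
    show "1 - max 0 (\<bar>u c\<bar> - 1) = 1" if "c \<in> coords n d \<times> UNIV" for c using assms[OF that] by simp
  qed simp
  then show ?thesis by (simp add: collar_time_def)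
qed

lemma collar_time_one:
  assumes "c \<in> coords n d \<times> UNIV" "\<bar>u c\<bar> = 2"
  shows "collar_time n d u = 1"
proof -
  have "(\<Prod>c\<in>coords n d \<times> (UNIV::bool set). 1 - max 0 (\<bar>u c\<bar> - 1)) = 0"
    using assms finite_coords by (intro prod_zero bexI[of _ c]) auto
  then show ?thesis by (simp add: collar_time_def)
qed

lemma continuous_on_apply: "continuous_on A (\<lambda>u :: 'i \<Rightarrow> real. u c)"
  by (rule continuous_on_subset[OF continuous_on_product_coordinates subset_UNIV])

lemma continuous_on_clamp1: "continuous_on A (\<lambda>u :: 'i \<Rightarrow> real. clamp1 (u c))"
  unfolding clamp1_def by (intro continuous_on_max continuous_on_min continuous_on_const continuous_on_apply)

lemma continuous_on_cell_map: "continuous_on A (cell_map n d)"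
proof -
  have "continuous_on A (\<lambda>u. cell_entry u p)" for p
    unfolding cell_entry_def Complex_eq
    by (intro continuous_on_add continuous_on_mult continuous_on_of_real continuous_on_const continuous_on_clamp1)
  moreover have "continuous_on A (\<lambda>u. complex_of_real (cell_pivot n d u i))" for i
    unfolding cell_pivot_def
    by (intro continuous_on_of_real continuous_on_prod continuous_on_diff continuous_on_power
        continuous_on_const continuous_on_clamp1)
  moreover have "continuous_on A (\<lambda>u. if P then g u else h u)"
    if "continuous_on A g" "continuous_on A h" for P and g h :: "_ \<Rightarrow> complex"
    using that by (cases P) simp_all
  ultimately have "continuous_on A (\<lambda>u. cell_map n d u i k)" for i k
    unfolding cell_map_def by (simp only: continuous_on_const)
  then show ?thesis
    by (intro continuous_on_coordinatewise_then_product)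
qed

lemma continuous_on_collar_time: "continuous_on A (collar_time n d)"
proof -
  have "continuous_on A (\<lambda>u. collar_time n d u)"
    unfolding collar_time_def
    by (intro continuous_on_diff continuous_on_prod continuous_on_max continuous_on_rabs
        continuous_on_const continuous_on_apply)
  then show ?thesis by simp
qed

text \<open>The extra factor for k > d - i is the pivot of row d - k, which sits at index d - (d -
  k) = k. It is real and nonnegative, so neither the conjugation nor the multiplication disturbs
  signs.\<close>

lemma model_map_cell_map:
  assumes p: "p \<in> coords n d" and "n \<le> d"
  shows "\<exists>s\<ge>0. model_map d (cell_map n d u) p = of_real s * cell_entry u p"
proof -
  obtain i k where [simp]: "p = (i, k)" by (cases p)
  have ik: "i \<in> {1..n}" "k < d" using p by (auto simp: coords_def)
  have e: "cell_map n d u i k = cell_entry u p" using p by (simp add: cell_map_def)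
  show ?thesis
  proof (cases "d - i < k")
    case True
    then have "d - k \<in> {1..n}" "d - (d - k) = k" using ik by auto
    moreover have "(d - k, k) \<notin> coords n d" using ik by (simp add: coords_def)
    ultimately have "cell_map n d u (d - k) k = of_real (cell_pivot n d u (d - k))"
      by (simp add: cell_map_def)
    then show ?thesis using True e cell_pivot_nonneg
      by (intro exI[of _ "cell_pivot n d u (d - k)"]) (simp add: model_map_def)
  next
    case False
    then show ?thesis using e by (intro exI[of _ 1]) (simp add: model_map_def)
  qed
qed

text \<open>On an outer face the time is 1 and the clamped tuple lies in a hyperplane, so
  \<open>H\<close> is the model map there and no component has the sign opposite to its own
  coordinate. Poincare-Miranda then produces a common zero of \<open>H\<close> over the
  cube.\<close>

lemma no_homotopy_to_model_map:
  assumes "n \<le> d"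
    and cont: "\<And>j. j \<in> coords n d \<Longrightarrow> continuous_on
      (nonzero_tuples n d \<times> {0} \<union> (\<Union>i\<in>{1..n}. hyperplane n d i) \<times> {0..1::real}) (\<lambda>x. H x j)"
    and nz: "\<And>x. x \<in> nonzero_tuples n d \<times> {0} \<union> (\<Union>i\<in>{1..n}. hyperplane n d i) \<times> {0..1} \<Longrightarrow>
      \<exists>j\<in>coords n d. H x j \<noteq> 0"
    and model: "\<And>v. v \<in> (\<Union>i\<in>{1..n}. hyperplane n d i) \<Longrightarrow> H (v, 1) = model_map d v"
  shows False
proof -
  define Y where "Y = (\<Union>i\<in>{1..n}. hyperplane n d i)"
  define D where "D = nonzero_tuples n d \<times> {0} \<union> Y \<times> {0..1::real}"
  define I where "I = coords n d \<times> (UNIV :: bool set)"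
  define \<Phi> where "\<Phi> u = (cell_map n d u, collar_time n d u)" for u
  define G where "G u c = (if snd c then Re (H (\<Phi> u) (fst c)) else Im (H (\<Phi> u) (fst c)))" for u c
  have I: "finite I" by (simp add: I_def finite_coords)
  have abs_le: "\<bar>u c\<bar> \<le> 2" if "u \<in> cube I (- 2) 2" "c \<in> I" for u c
    using that by (auto simp: cube_def abs_le_iff)
  \<comment> \<open>Clamping keeps the collar inside the domain of \<open>H\<close>: the time is
    nonzero only where some coordinate exceeds 1 in absolute value, and there the tuple already lies
    in \<open>Y\<close>.\<close>
  have \<Phi>D: "\<Phi> u \<in> D" if u: "u \<in> cube I (- 2) 2" for u
  proof (cases "\<forall>c\<in>I. \<bar>u c\<bar> \<le> 1")
    case True
    then have "collar_time n d u = 0" unfolding I_def by (intro collar_time_zero) auto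
    then show ?thesis
      using cell_map_nonzero_tuples[OF \<open>n \<le> d\<close>, of u] by (simp add: \<Phi>_def D_def)
  next
    case False
    then obtain c where "c \<in> I" "1 \<le> \<bar>u c\<bar>" by force
    then have "cell_map n d u \<in> Y"
      using cell_map_hyperplane[OF \<open>n \<le> d\<close>] unfolding I_def Y_def by blast
    moreover have "collar_time n d u \<in> {0..1}"
      using abs_le[OF u] unfolding I_def by (intro collar_time_bounds) auto
    ultimately show ?thesis by (simp add: \<Phi>_def D_def)
  qed
  have cont\<Phi>: "continuous_on A \<Phi>" for A
    unfolding \<Phi>_def using continuous_on_cell_map continuous_on_collar_time
    by (intro continuous_on_Pair)
  have contH: "continuous_on (cube I (- 2) 2) (\<lambda>u. H (\<Phi> u) j)" if "j \<in> coords n d" for j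
  proof (rule continuous_on_compose2[of D "\<lambda>x. H x j"])
    show "continuous_on D (\<lambda>x. H x j)" unfolding D_def Y_def using that by (rule cont)
    show "\<Phi> ` cube I (- 2) 2 \<subseteq> D" using \<Phi>D by blast
  qed (rule cont\<Phi>)
  have face: "\<exists>s\<ge>0. G u c = s * clamp1 (u c)" if u: "u \<in> cube I (- 2) 2" "c \<in> I" "\<bar>u c\<bar> = 2" for u c
  proof -
    have c: "c \<in> coords n d \<times> UNIV" using u(2) by (simp add: I_def)
    have "cell_map n d u \<in> Y"
      using cell_map_hyperplane[OF \<open>n \<le> d\<close> c] u(3) unfolding Y_def by simp
    then have "H (\<Phi> u) = model_map d (cell_map n d u)"
      using model collar_time_one[of c n d u, OF c u(3)] unfolding \<Phi>_def Y_def by simp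
    moreover obtain s where "s \<ge> 0" "model_map d (cell_map n d u) (fst c) = of_real s * cell_entry u (fst c)"
      using model_map_cell_map[of "fst c" n d u] c \<open>n \<le> d\<close> by auto
    moreover have "u (fst c, True) = u c" if "snd c" using that by (cases c) simp
    moreover have "u (fst c, False) = u c" if "\<not> snd c" using that by (cases c) simp
    ultimately show ?thesis
      by (intro exI[of _ s]) (simp add: G_def cell_entry_def)
  qed
  have "\<exists>u\<in>cube I (- 2) 2. \<forall>c\<in>I. G u c = 0"
  proof (rule poincare_miranda[OF I])
    show "continuous_on (cube I (- 2) 2) (\<lambda>u. G u c)" if "c \<in> I" for c
      using contH[of "fst c"] that
      by (cases "snd c") (auto simp: G_def I_def intro!: continuous_on_Re continuous_on_Im)
    show "G u c \<le> 0" if "u \<in> cube I (- 2) 2" "c \<in> I" "u c = - 2" for u c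
      using face[OF that(1,2)] that(3) by (auto simp: clamp1_def)
    show "0 \<le> G u c" if "u \<in> cube I (- 2) 2" "c \<in> I" "u c = 2" for u c
      using face[OF that(1,2)] that(3) by (auto simp: clamp1_def)
  qed simp
  then obtain u where u: "u \<in> cube I (- 2) 2" "\<forall>c\<in>I. G u c = 0" by blast
  have "H (\<Phi> u) j = 0" if "j \<in> coords n d" for j
  proof -
    have "G u (j, True) = 0" "G u (j, False) = 0" using u(2) that by (auto simp: I_def)
    then show ?thesis by (simp add: G_def complex_eq_iff)
  qed
  moreover have "\<exists>j\<in>coords n d. H (\<Phi> u) j \<noteq> 0"
    using \<Phi>D[OF u(1)] unfolding D_def Y_def by (rule nz)
  ultimately show False by blast
qed

lemma weighted_map_has_zero:
  assumes "n \<le> d"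
  shows "\<not> weighted_map n d (coords n d) True (nonzero_tuples n d \<times> {0}) F"
proof
  assume "weighted_map n d (coords n d) True (nonzero_tuples n d \<times> {0}) F"
  from homotopy_to_model_map[OF assms this] obtain H where H: "\<forall>j\<in>coords n d. continuous_on
      (nonzero_tuples n d \<times> {0} \<union> (\<Union>i\<in>{1..n}. hyperplane n d i) \<times> {0..1::real}) (\<lambda>x. H x j)"
    "\<forall>x\<in>nonzero_tuples n d \<times> {0} \<union> (\<Union>i\<in>{1..n}. hyperplane n d i) \<times> {0..1}.
      \<exists>j\<in>coords n d. H x j \<noteq> 0"
    "\<forall>v\<in>(\<Union>i\<in>{1..n}. hyperplane n d i). H (v, 1) = model_map d v"
    by (elim exE conjE)
  show False
    by (rule no_homotopy_to_model_map[OF assms bspec[OF H(1)] bspec[OF H(2)] bspec[OF H(3)]])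
qed

section \<open>Extending a map on the Stiefel manifold\<close>

definition euclidean_norm :: "nat \<Rightarrow> (nat \<Rightarrow> complex) \<Rightarrow> real" where
  "euclidean_norm d v = sqrt (\<Sum>k<d. (cmod (v k))\<^sup>2)"

text \<open>Rows outside \<open>{1..n}\<close> have norm 0, and the convention
  \<open>inverse 0 = 0\<close> leaves them zero.\<close>

definition normalize_tuple :: "nat \<Rightarrow> (nat \<Rightarrow> nat \<Rightarrow> complex) \<Rightarrow> nat \<Rightarrow> nat \<Rightarrow> complex" where
  "normalize_tuple d v = torus_act (\<lambda>i. inverse (of_real (euclidean_norm d (v i)))) v"

text \<open>The saturation of \<open>stiefel n d\<close> under \<open>scalars n\<close>.\<close>

definition orthogonal_tuples :: "nat \<Rightarrow> nat \<Rightarrow> (nat \<Rightarrow> nat \<Rightarrow> complex) set" where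
  "orthogonal_tuples n d = {v \<in> nonzero_tuples n d.
    \<forall>i\<in>{1..n}. \<forall>j\<in>{1..n}. i \<noteq> j \<longrightarrow> hermitian_inner d (v i) (v j) = 0}"

lemma hermitian_inner_scale:
  "hermitian_inner d (\<lambda>k. a * v k) (\<lambda>k. b * w k) = a * cnj b * hermitian_inner d v w"
  by (simp add: hermitian_inner_def sum_distrib_left algebra_simps)

lemma hermitian_inner_self: "hermitian_inner d v v = of_real ((euclidean_norm d v)\<^sup>2)"
proof -
  have "0 \<le> (\<Sum>k<d. (cmod (v k))\<^sup>2)" by (intro sum_nonneg) simp
  then show ?thesis
    by (simp add: hermitian_inner_def euclidean_norm_def complex_norm_square[symmetric] del: of_real_power)
qed

lemma hermitian_inner_commute: "hermitian_inner d w v = cnj (hermitian_inner d v w)"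
  by (simp add: hermitian_inner_def mult.commute)

lemma euclidean_norm_scale: "euclidean_norm d (\<lambda>k. a * v k) = cmod a * euclidean_norm d v"
  by (simp add: euclidean_norm_def norm_mult power_mult_distrib real_sqrt_mult flip: sum_distrib_left)

lemma euclidean_norm_pos:
  assumes "v \<in> nonzero_tuples n d" "i \<in> {1..n}"
  shows "0 < euclidean_norm d (v i)"
proof -
  have "v i \<noteq> (\<lambda>k. 0)" using assms by (simp add: nonzero_tuples_def)
  then obtain k where k: "v i k \<noteq> 0" by (meson ext)
  then have "k < d"
    using assms by (auto simp: nonzero_tuples_def direct_sum_def complex_space_def not_le[symmetric])
  then have "0 < (\<Sum>k<d. (cmod (v i k))\<^sup>2)"
    using k by (intro sum_pos2[of _ k]) auto
  then show ?thesis by (simp add: euclidean_norm_def)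
qed

lemma normalize_tuple_stiefel:
  assumes v: "v \<in> orthogonal_tuples n d"
  shows "normalize_tuple d v \<in> stiefel n d"
proof -
  have nz: "v \<in> nonzero_tuples n d" using v by (simp add: orthogonal_tuples_def)
  have "normalize_tuple d v \<in> direct_sum n (\<lambda>i. d)"
    using nz by (simp add: normalize_tuple_def torus_act_def nonzero_tuples_def direct_sum_def complex_space_def)
  moreover have "hermitian_inner d (normalize_tuple d v i) (normalize_tuple d v j) = (if i = j then 1 else 0)"
    if ij: "i \<in> {1..n}" "j \<in> {1..n}" for i j
  proof -
    have eq: "hermitian_inner d (normalize_tuple d v i) (normalize_tuple d v j) =
        inverse (of_real (euclidean_norm d (v i))) * cnj (inverse (of_real (euclidean_norm d (v j)))) *
        hermitian_inner d (v i) (v j)"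
      unfolding normalize_tuple_def torus_act_def by (rule hermitian_inner_scale)
    show ?thesis
    proof (cases "i = j")
      case True
      then show ?thesis
        unfolding eq using euclidean_norm_pos[OF nz ij(1)]
        by (simp add: hermitian_inner_self power2_eq_square field_simps)
    next
      case False
      then show ?thesis using eq v ij by (simp add: orthogonal_tuples_def)
    qed
  qed
  ultimately show ?thesis by (simp add: stiefel_def)
qed

lemma orthogonal_tuples_torus_act:
  assumes "l \<in> scalars n" "v \<in> orthogonal_tuples n d"
  shows "torus_act l v \<in> orthogonal_tuples n d"
  using assms torus_act_nonzero_tuples[of l n v d]
  by (simp add: orthogonal_tuples_def torus_act_def hermitian_inner_scale)

lemma continuous_on_hermitian_inner:
  fixes A :: "((nat \<Rightarrow> nat \<Rightarrow> complex) \<times> real) set"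
  shows "continuous_on A (\<lambda>x. hermitian_inner d (fst x i) (fst x j))"
  unfolding hermitian_inner_def
  by (intro continuous_on_sum continuous_on_mult continuous_on_cnj continuous_on_fst_apply)

lemma continuous_on_euclidean_norm:
  fixes A :: "((nat \<Rightarrow> nat \<Rightarrow> complex) \<times> real) set"
  shows "continuous_on A (\<lambda>x. euclidean_norm d (fst x i))"
  unfolding euclidean_norm_def
  by (intro continuous_on_real_sqrt continuous_on_sum continuous_on_power continuous_on_norm continuous_on_fst_apply)

lemma invariant_closed_orthogonal: "invariant_closed n d (orthogonal_tuples n d \<times> {0})"
proof -
  have "closed {x :: (nat \<Rightarrow> nat \<Rightarrow> complex) \<times> real.
      (\<forall>i j. i \<in> {1..n} \<and> j \<in> {1..n} \<and> i \<noteq> j \<longrightarrow> hermitian_inner d (fst x i) (fst x j) = 0) \<and> snd x = 0}"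
    by (intro closed_Collect_conj closed_Collect_all closed_Collect_imp open_Collect_const closed_Collect_eq
        continuous_on_hermitian_inner continuous_on_const continuous_on_snd continuous_on_id)
  then have "closedin (top_of_set (nonzero_tuples n d \<times> UNIV)) (nonzero_tuples n d \<times> UNIV \<inter> {x.
      (\<forall>i j. i \<in> {1..n} \<and> j \<in> {1..n} \<and> i \<noteq> j \<longrightarrow> hermitian_inner d (fst x i) (fst x j) = 0) \<and> snd x = (0::real)})"
    by (rule closedin_closed_Int)
  moreover have "nonzero_tuples n d \<times> UNIV \<inter> {x.
      (\<forall>i j. i \<in> {1..n} \<and> j \<in> {1..n} \<and> i \<noteq> j \<longrightarrow> hermitian_inner d (fst x i) (fst x j) = 0) \<and> snd x = (0::real)} =
      orthogonal_tuples n d \<times> {0}"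
    by (auto simp: orthogonal_tuples_def)
  ultimately show ?thesis
    using orthogonal_tuples_torus_act by (auto simp: invariant_closed_def)
qed

theorem theorem1p4:
  fixes d n :: nat
    and f :: "(nat \<Rightarrow> nat \<Rightarrow> complex) \<Rightarrow> (nat \<Rightarrow> nat \<Rightarrow> complex)"
  assumes "1 \<le> n" and "n \<le> d"
    and "f \<in> stiefel n d \<rightarrow> direct_sum n (\<lambda>i. d - i)"
    and "continuous_on (stiefel n d) f"
    and "torus_equivariant_on n (stiefel n d) f"
  shows "\<exists>v\<in>stiefel n d. f v = (\<lambda>i k. 0)"
proof (rule ccontr)
  assume contra: "\<not> ?thesis"
  let ?X = "nonzero_tuples n d"
  define W where "W = orthogonal_tuples n d"
  define J where "J = {(i, k) \<in> coords n d. k < d - i}"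
  define f1 :: "(nat \<Rightarrow> nat \<Rightarrow> complex) \<times> real \<Rightarrow> nat \<times> nat \<Rightarrow> complex" where
    \<comment> \<open>The norm makes component i homogeneous of degree 1 in v_i: equivariance of
      \<open>f\<close> accounts for the phase of \<open>l i\<close> only, the norm supplies its
      modulus, and together they give the weight \<open>l i\<close>.\<close>
    "f1 x = (\<lambda>(i, k). of_real (euclidean_norm d (fst x i)) * f (normalize_tuple d (fst x)) i k)" for x
  have W_X: "v \<in> ?X" if "v \<in> W" for v using that by (simp add: W_def orthogonal_tuples_def)
  have J_in: "i \<in> {1..n} \<and> k < d - i \<and> weight d l (i, k) = l i" if "(i, k) \<in> J" for i k l
    using that by (auto simp: J_def coords_def weight_def)
  have nz: "\<exists>j\<in>J. f1 (v, t) j \<noteq> 0" if v: "v \<in> W" for v t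
  proof -
    let ?N = "normalize_tuple d v"
    have N: "?N \<in> stiefel n d" using v normalize_tuple_stiefel by (simp add: W_def)
    have "f ?N \<noteq> (\<lambda>i k. 0)" using contra N by blast
    then obtain i k where ik: "f ?N i k \<noteq> 0" by (meson ext)
    have "f ?N \<in> direct_sum n (\<lambda>i. d - i)" using assms(3) N by blast
    then have "i \<in> {1..n}" "k < d - i"
      using ik by (auto simp: direct_sum_def complex_space_def not_le[symmetric])
    then have "(i, k) \<in> J" by (auto simp: J_def coords_def)
    moreover have "f1 (v, t) (i, k) \<noteq> 0"
      using ik euclidean_norm_pos[OF W_X[OF v] \<open>i \<in> {1..n}\<close>] by (simp add: f1_def)
    ultimately show ?thesis by blast
  qed
  \<comment> \<open>The flag is \<open>False\<close> although \<open>f1\<close> has no zero on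
    \<open>W\<close>, because the extension off \<open>W\<close> is allowed to acquire
    zeros.\<close>
  have "weighted_map n d J False (W \<times> {0}) f1"
    unfolding weighted_map_def
  proof (intro conjI ballI allI impI)
    fix j assume "j \<in> J"
    obtain i k where [simp]: "j = (i, k)" by (cases j)
    have "continuous_on (W \<times> {0}) (\<lambda>x :: (nat \<Rightarrow> nat \<Rightarrow> complex) \<times> real. normalize_tuple d (fst x) i k)" for i k
    proof (cases "i \<in> {1..n}")
      case True
      have "euclidean_norm d (fst x i) \<noteq> 0" if "x \<in> W \<times> {0::real}" for x
        using euclidean_norm_pos[OF W_X True, of "fst x"] that by auto
      then show ?thesis
        unfolding normalize_tuple_def torus_act_def
        by (intro continuous_on_mult continuous_on_inverse continuous_on_of_real
            continuous_on_euclidean_norm continuous_on_fst_apply) auto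
    next
      case False
      have "normalize_tuple d (fst x) i k = 0" if "x \<in> W \<times> {0::real}" for x
        using W_X[of "fst x"] that False
        by (auto simp: normalize_tuple_def torus_act_def nonzero_tuples_def direct_sum_def)
      then show ?thesis
        by (intro continuous_on_eq[OF continuous_on_const[of _ 0]]) simp
    qed
    then have "continuous_on (W \<times> {0}) (\<lambda>x :: (nat \<Rightarrow> nat \<Rightarrow> complex) \<times> real. normalize_tuple d (fst x))"
      by (intro continuous_on_coordinatewise_then_product)
    then have "continuous_on (W \<times> {0}) (\<lambda>x :: (nat \<Rightarrow> nat \<Rightarrow> complex) \<times> real. f (normalize_tuple d (fst x)))"
    proof (rule continuous_on_compose2[OF assms(4)])
      show "(\<lambda>x. normalize_tuple d (fst x)) ` (W \<times> {0}) \<subseteq> stiefel n d"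
        using normalize_tuple_stiefel by (auto simp: W_def)
    qed
    then have "continuous_on (W \<times> {0}) (\<lambda>x :: (nat \<Rightarrow> nat \<Rightarrow> complex) \<times> real. f (normalize_tuple d (fst x)) i k)"
      by (rule continuous_on_product_then_coordinatewise[OF continuous_on_product_then_coordinatewise])
    then show "continuous_on (W \<times> {0}) (\<lambda>x. f1 x j)"
      unfolding f1_def
      by (simp add: continuous_on_mult continuous_on_of_real continuous_on_euclidean_norm)
  next
    fix l v and t :: real and j
    assume l: "l \<in> scalars n" and vt: "(v, t) \<in> W \<times> {0}" and j: "j \<in> J"
    obtain i k where [simp]: "j = (i, k)" by (cases j)
    have i: "i \<in> {1..n}" using J_in j by simp
    have v: "v \<in> W" using vt by simp
    \<comment> \<open>The phases of \<open>l\<close>, restricted because elements of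
      \<open>torus n\<close> are extensional functions.\<close>
    define u where "u = (\<lambda>i\<in>{1..n}. l i / of_real (cmod (l i)))"
    have "u \<in> torus n"
      using l by (auto simp: u_def torus_def scalars_def norm_divide)
    have "normalize_tuple d (torus_act l v) = torus_act u (normalize_tuple d v)"
    proof (intro ext)
      fix i k
      show "normalize_tuple d (torus_act l v) i k = torus_act u (normalize_tuple d v) i k"
      proof (cases "i \<in> {1..n}")
        case True
        then show ?thesis
          by (simp add: normalize_tuple_def torus_act_def euclidean_norm_scale u_def field_simps)
      next
        case False
        then have "v i k = 0" using W_X[OF v] by (simp add: nonzero_tuples_def direct_sum_def)
        then show ?thesis by (simp add: normalize_tuple_def torus_act_def)
      qed
    qed
    moreover have "normalize_tuple d v \<in> stiefel n d"
      using v normalize_tuple_stiefel by (simp add: W_def)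
    ultimately have "f (normalize_tuple d (torus_act l v)) = torus_act u (f (normalize_tuple d v))"
      using assms(5) \<open>u \<in> torus n\<close> by (simp add: torus_equivariant_on_def)
    moreover have "of_real (cmod (l i)) * u i = l i"
      using l i by (simp add: u_def scalars_def)
    moreover have "euclidean_norm d (torus_act l v i) = cmod (l i) * euclidean_norm d (v i)"
      by (simp add: torus_act_def euclidean_norm_scale)
    ultimately have "f1 (torus_act l v, t) j = (of_real (cmod (l i)) * u i) * f1 (v, t) j"
      by (simp add: f1_def torus_act_def)
    also have "\<dots> = weight d l j * f1 (v, t) j"
      using J_in[of i k l] j \<open>of_real (cmod (l i)) * u i = l i\<close> by simp
    finally show "f1 (torus_act l v, t) j = weight d l j * f1 (v, t) j" .
  qed simp
  \<comment> \<open>All tuples are covered, at time 0. Since zeros are allowed, Tietze's theorem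
    handles every chart and no dimension count enters.\<close>
  moreover define \<P> where "\<P> = (\<lambda>m. (?X \<times> {0::real}, m)) ` ({1..n} \<rightarrow>\<^sub>E {..<d})"
  moreover define A where "A = W \<times> {0} \<union> (\<Union>(B, m)\<in>\<P>. B \<inter> dominated n d m \<times> UNIV)"
  moreover have "J \<subseteq> coords n d" by (auto simp: J_def)
  ultimately have "\<exists>F. weighted_map n d J False A F \<and>
      (\<forall>x\<in>W \<times> {0}. F x = f1 x)"
    unfolding A_def
  proof (intro weighted_extension)
    show "finite \<P>" unfolding \<P>_def by (intro finite_imageI finite_PiE) auto
    show "invariant_closed n d (W \<times> {0})" unfolding W_def by (rule invariant_closed_orthogonal)
    show "invariant_closed n d B" if "(B, m) \<in> \<P>" for B m
      using that invariant_closed_slice[of "{0}"] by (auto simp: \<P>_def)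
  qed (auto intro: extends_from_closed_tietze)
  then obtain F where F: "weighted_map n d J False A F"
    and F_f1: "\<forall>x\<in>W \<times> {0}. F x = f1 x"
    by (elim exE conjE)
  have F_cont: "\<And>j. j \<in> J \<Longrightarrow>
      continuous_on A (\<lambda>x. F x j)"
    and F_weight: "\<And>l v t j. l \<in> scalars n \<Longrightarrow>
      (v, t) \<in> A \<Longrightarrow> j \<in> J \<Longrightarrow>
      F (torus_act l v, t) j = weight d l j * F (v, t) j"
    using F unfolding weighted_map_def by simp_all
  have sub: "?X \<times> {0::real} \<subseteq> A"
  proof
    fix x :: "(nat \<Rightarrow> nat \<Rightarrow> complex) \<times> real" assume x: "x \<in> ?X \<times> {0}"
    then have "fst x \<in> ?X" by auto
    then obtain m where m: "m \<in> {1..n} \<rightarrow>\<^sub>E {..<d}" "fst x \<in> dominated n d m"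
      using nonzero_tuples_subset_dominated by blast
    have "(?X \<times> {0}, m) \<in> \<P>" using m by (simp add: \<P>_def)
    moreover have "x \<in> ?X \<times> {0} \<inter> dominated n d m \<times> UNIV" using x m by (cases x) simp
    ultimately show "x \<in> A" unfolding A_def by blast
  qed
  \<comment> \<open>On \<open>W\<close> the components in \<open>J\<close> are those of
    \<open>f1\<close>, one of which is nonzero; off \<open>W\<close> some inner product is nonzero,
    so zeros of \<open>F\<close> there do no harm.\<close>
  define G where "G x = (\<lambda>(i, k). if k < d - i then F x (i, k)
    else hermitian_inner d (fst x i) (fst x (d - k)))" for x
  have "weighted_map n d (coords n d) True (?X \<times> {0}) G"
    unfolding weighted_map_def
  proof (intro conjI ballI allI impI)
    fix j assume j: "j \<in> coords n d"
    obtain i k where [simp]: "j = (i, k)" by (cases j)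
    show "continuous_on (?X \<times> {0}) (\<lambda>x. G x j)"
    proof (cases "k < d - i")
      case True
      then have "j \<in> J" using j by (simp add: J_def)
      have "continuous_on (?X \<times> {0}) (\<lambda>x. F x j)"
        using F_cont[OF \<open>j \<in> J\<close>] sub by (rule continuous_on_subset)
      then show ?thesis using True by (simp add: G_def)
    next
      case False
      then show ?thesis by (simp add: G_def continuous_on_hermitian_inner)
    qed
  next
    fix l v and t :: real and j
    assume l: "l \<in> scalars n" and vt: "(v, t) \<in> ?X \<times> {0}" and j: "j \<in> coords n d"
    obtain i k where [simp]: "j = (i, k)" by (cases j)
    show "G (torus_act l v, t) j = weight d l j * G (v, t) j"
    proof (cases "k < d - i")
      case True
      then have "j \<in> J" using j by (simp add: J_def)
      have "F (torus_act l v, t) j = weight d l j * F (v, t) j"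
        by (rule F_weight[OF l subsetD[OF sub vt] \<open>j \<in> J\<close>])
      then show ?thesis using True by (simp add: G_def)
    next
      case False
      then have "d - i < k" using j by (auto simp: coords_def)
      then show ?thesis
        by (simp add: G_def weight_def torus_act_def hermitian_inner_scale)
    qed
  next
    fix x assume x: "x \<in> ?X \<times> {0::real}"
    show "\<exists>j\<in>coords n d. G x j \<noteq> 0"
    proof (cases "fst x \<in> W")
      case True
      then obtain i k where ik: "(i, k) \<in> J" "f1 x (i, k) \<noteq> 0"
        using nz[of "fst x" "snd x"] by auto
      moreover have "F x = f1 x" using True x F_f1 by (cases x) auto
      ultimately have "G x (i, k) \<noteq> 0" using J_in by (simp add: G_def)
      moreover have "(i, k) \<in> coords n d" using ik by (simp add: J_def)
      ultimately show ?thesis by blast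
    next
      case False
      then obtain i j where ij: "i \<in> {1..n}" "j \<in> {1..n}" "i \<noteq> j"
        "hermitian_inner d (fst x i) (fst x j) \<noteq> 0"
        using x by (auto simp: W_def orthogonal_tuples_def)
      \<comment> \<open>For j < i the index k = d - j satisfies d - i < k < d, so this inner product
        is one of the components. The opposite order reduces to this one by conjugation.\<close>
      have *: "\<exists>p\<in>coords n d. G x p \<noteq> 0"
        if "i \<in> {1..n}" "j \<in> {1..n}" "j < i" "hermitian_inner d (fst x i) (fst x j) \<noteq> 0" for i j
      proof -
        have "(i, d - j) \<in> coords n d" "\<not> d - j < d - i" "d - (d - j) = j"
          using that \<open>n \<le> d\<close> by (auto simp: coords_def)
        then show ?thesis using that(4) by (intro bexI[of _ "(i, d - j)"]) (simp_all add: G_def)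
      qed
      show ?thesis
      proof (cases "j < i")
        case True
        then show ?thesis using *[of i j] ij by blast
      next
        case False
        have "hermitian_inner d (fst x j) (fst x i) \<noteq> 0"
          using ij(4) hermitian_inner_commute[of d "fst x j" "fst x i"] by simp
        then show ?thesis using *[of j i] ij False by simp
      qed
    qed
  qed
  then show False using weighted_map_has_zero[OF \<open>n \<le> d\<close>] by blast
qed

end
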